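(* There exists $\lambda_0>0$ such that if $\lambda\geq\lambda_0$, then the transcendental self-map of $\mathbb{C}^*$ given by $$f_\lambda(z):=\lambda z\exp\left(\frac{e^{-z}}{z}\right)=\lambda z\exp\left(\frac{e^{-z}-1}{z}+\frac1z\right)$$ has the property that its escaping set $I(f_\lambda)$ is a $\mathbb{C}^*$-spider's web.
   Context: $\mathbb{C}^* := \mathbb{C}\setminus\{0\}$ and $\widehat{\mathbb{C}} := \mathbb{C}\cup\{\infty\}$. A transcendental self-map of $\mathbb{C}^*$ is a holomorphic function $f:\mathbb{C}^*\to\mathbb{C}^*$ for which both $0$ and $\infty$ are essential singularities. Escaping set: $I(f):=\{z\in\mathbb{C}^*:\omega(z,f)\subset\{0,\infty\}\}$, where $\omega(z,f):=\bigcap_{n\in\mathbb{N}}\overline{\{f^k(z):k\geq n\}}$ with closure taken in $\widehat{\mathbb{C}}$, and $f^k$ is the $k$-th iterate of $f$. A set $X\subset\mathbb{C}^*$ is bounded in $\mathbb{C}^*$ if its closure in $\widehat{\mathbb{C}}$ does not meet $\{0,\infty\}$. $\mathbb{C}^*$-spider's web: a set $E\subset\mathbb{C}^*$ is a $\mathbb{C}^*$-spider's web if $E$ is connected and there exists a sequence of domains $(G_n')_{n\in\mathbb{N}}$, each bounded in $\mathbb{C}^*$, such that (a) each $G_n'$ is doubly connected and separates $0$ from $\infty$ (so $\widehat{\mathbb{C}}\setminus G_n'$ has exactly two components, one containing $0$ and the other containing $\infty$); (b) $G_n'\subset G_{n+1}'$ and $\partial G_n'\subset E$ for $n\in\mathbb{N}$;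 (c) $\bigcup_{n\in\mathbb{N}}G_n'=\mathbb{C}^*$. *)

theory Defs
  imports "HOL-Complex_Analysis.Complex_Analysis"
begin

text \<open>
  The Riemann sphere is the one-point compactification of the plane, with \<^term>\<open>Some z\<close> for
  a finite point and \<^term>\<open>None\<close> for the point at infinity.
\<close>

definition riemann_sphere :: "complex option topology" where
  "riemann_sphere = Alexandroff_compactification (euclidean :: complex topology)"

abbreviation punctured_plane :: "complex set" where
  "punctured_plane \<equiv> - {0}"

definition essential_singularity_at :: "(complex \<Rightarrow> complex) \<Rightarrow> complex \<Rightarrow> bool" where
  "essential_singularity_at f z \<longleftrightarrow> isolated_singularity_at f z \<and> \<not> not_essential f z"

definition essential_singularity_at_infinity :: "(complex \<Rightarrow> complex) \<Rightarrow> bool" where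
  "essential_singularity_at_infinity f \<longleftrightarrow> essential_singularity_at (\<lambda>w. f (1 / w)) 0"

text \<open>Only the values of \<^term>\<open>f\<close> on the punctured plane matter; its value at 0 is junk.\<close>

definition transcendental_self_map :: "(complex \<Rightarrow> complex) \<Rightarrow> bool" where
  "transcendental_self_map f \<longleftrightarrow>
     f holomorphic_on punctured_plane \<and> f ` punctured_plane \<subseteq> punctured_plane \<and>
     essential_singularity_at f 0 \<and> essential_singularity_at_infinity f"

definition omega_limit :: "complex \<Rightarrow> (complex \<Rightarrow> complex) \<Rightarrow> complex option set" where
  "omega_limit z f = (\<Inter>n. riemann_sphere closure_of {Some ((f ^^ k) z) | k. k \<ge> n})"

definition escaping_set :: "(complex \<Rightarrow> complex) \<Rightarrow> complex set" where
  "escaping_set f = {z \<in> punctured_plane. omega_limit z f \<subseteq> {Some 0, None}}"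

definition bounded_in_punctured_plane :: "complex set \<Rightarrow> bool" where
  "bounded_in_punctured_plane X \<longleftrightarrow>
     X \<subseteq> punctured_plane \<and> (riemann_sphere closure_of (Some ` X)) \<inter> {Some 0, None} = {}"

definition domain_in_plane :: "complex set \<Rightarrow> bool" where
  "domain_in_plane G \<longleftrightarrow> open G \<and> connected G \<and> G \<noteq> {}"

definition doubly_connected_separating :: "complex set \<Rightarrow> bool" where
  "doubly_connected_separating G \<longleftrightarrow>
     (\<exists>A B. A \<noteq> B \<and> Some 0 \<in> A \<and> None \<in> B \<and>
        connected_components_of
          (subtopology riemann_sphere (topspace riemann_sphere - Some ` G)) = {A, B})"

text \<open>
  The boundary is taken in the plane. For a set bounded in the punctured plane it is the same as
  the boundary in the sphere.
\<close>

definition punctured_spiders_web :: "complex set \<Rightarrow> bool" where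
  "punctured_spiders_web E \<longleftrightarrow>
     E \<subseteq> punctured_plane \<and> connected E \<and>
     (\<exists>G :: nat \<Rightarrow> complex set.
        (\<forall>n. domain_in_plane (G n) \<and> bounded_in_punctured_plane (G n)) \<and>
        (\<forall>n. doubly_connected_separating (G n)) \<and>
        (\<forall>n. G n \<subseteq> G (Suc n) \<and> frontier (G n) \<subseteq> E) \<and>
        (\<Union>n. G n) = punctured_plane)"

definition f_lam :: "real \<Rightarrow> complex \<Rightarrow> complex" where
  "f_lam c z = of_real c * z * exp (exp (- z) / z)"

lemma f_lam_alt: "f_lam c z = of_real c * z * exp ((exp (- z) - 1) / z + 1 / z)"
  by (simp add: f_lam_def diff_divide_distrib)

end

theory Submission
  imports Defs "HOL-Real_Asymp.Real_Asymp"
begin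

text \<open>
  Write \<open>f\<close> for the map and \<open>A z = exp (- z) / z\<close>, so that
  \<open>ln |f z| = ln |z| + ln c + Re (A z)\<close>. The union \<open>P\<close> of the half-plane \<open>Re z \<ge> 1\<close> and the positive
  half-line is mapped into itself and escapes to infinity. Let a curve cross a logarithmic annulus
  close to 0 or to infinity such that neither the curve nor its image meets \<open>P\<close>. Then
  \<open>Im A\<close> varies by less than \<open>4 \<pi>\<close> along it, since the argument of \<open>f\<close> cannot pass 0, whereas
  \<open>|A|\<close> varies by a factor of at least 10; hence \<open>|Re A|\<close> varies a lot and the image again crosses an
  annulus, closer to 0 or to infinity. Nested intervals give a point of the curve in the closed
  subset of the escaping set formed by the points that escape at a linear rate until they possibly enter
  \<open>P\<close>. So this closed set separates 0 from infinity inside every such annulus, and the domains of the web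
  are cut out by it.

  If the escaping set were disconnected, a continuum outside it would separate an escaping
  point from \<open>P\<close>. The iterated images of the continuum avoid the boundaries of all the domains of
  the web, and by the maximum principle they leave each of these domains together with the orbit of
  the point; so the continuum would itself escape.
\<close>

section \<open>The map and its expansion rate\<close>

text \<open>The function \<open>A\<close> of the overview.\<close>

definition expo :: "complex \<Rightarrow> complex" where
  "expo z = exp (- z) / z"

text \<open>The set \<open>P\<close> of the overview. Its half-line serves as a branch cut: a curve
  off this set and off 0 carries a continuous argument, and so does its image if that avoids the set
  too.\<close>

definition haven :: "complex set" where
  "haven = {z. 1 \<le> Re z} \<union> {z. Im z = 0 \<and> 0 < Re z}"

abbreviation lnorm :: "complex \<Rightarrow> real" where
  "lnorm z \<equiv> \<bar>ln (cmod z)\<bar>"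

lemma f_lam_expo: "f_lam c z = of_real c * z * exp (expo z)"
  by (simp add: f_lam_def expo_def)

lemma norm_expo: "cmod (expo z) = exp (- Re z) / cmod z"
  by (simp add: expo_def norm_divide)

lemma norm_f_lam: "c > 0 \<Longrightarrow> cmod (f_lam c z) = c * cmod z * exp (Re (expo z))"
  by (simp add: f_lam_expo norm_mult)

lemma f_lam_eq_0_iff: "c > 0 \<Longrightarrow> f_lam c z = 0 \<longleftrightarrow> z = 0"
  by (simp add: f_lam_def)

lemma ln_norm_f_lam:
  assumes "c > 0" "z \<noteq> 0"
  shows "ln (cmod (f_lam c z)) = ln (cmod z) + ln c + Re (expo z)"
  using assms by (simp add: norm_f_lam ln_mult)

lemma f_lam_cnj: "f_lam c (cnj z) = cnj (f_lam c z)"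
  by (simp add: f_lam_def exp_cnj)

lemma cnj_haven: "cnj z \<in> haven \<longleftrightarrow> z \<in> haven"
  by (simp add: haven_def)

lemma f_lam_positive_real:
  assumes "c > 0" "x > 0"
  shows "Im (f_lam c (of_real x)) = 0" "Re (f_lam c (of_real x)) \<ge> c"
proof -
  have eq: "f_lam c (of_real x) = of_real (c * x * exp (exp (- x) / x))"
    by (simp add: f_lam_def exp_of_real flip: of_real_minus of_real_divide)
  then show "Im (f_lam c (of_real x)) = 0"
    by (simp only: Im_complex_of_real)
  \<comment> \<open>The bound \<open>1 + t \<le> exp t\<close> is used twice, at
    \<open>t = - x\<close> and at \<open>t = 1 / x - 1\<close>; together they give
    \<open>x * exp (exp (- x) / x) \<ge> 1\<close>.\<close>
  have "exp (- x) / x \<ge> (1 - x) / x"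
    using exp_ge_add_one_self[of "- x"] assms by (intro divide_right_mono) auto
  then have "exp (- x) / x \<ge> 1 / x - 1"
    using assms by (simp add: diff_divide_distrib)
  moreover have "exp (1 / x - 1) \<ge> 1 / x"
    using exp_ge_add_one_self[of "1 / x - 1"] by simp
  ultimately have "exp (exp (- x) / x) \<ge> 1 / x"
    by (meson exp_le_cancel_iff order_trans)
  then have "x * exp (exp (- x) / x) \<ge> 1"
    using assms by (simp add: field_simps)
  then have "c * (x * exp (exp (- x) / x)) \<ge> c * 1"
    using assms by (intro mult_left_mono) auto
  then show "Re (f_lam c (of_real x)) \<ge> c"
    unfolding eq by (simp only: Re_complex_of_real mult_1_right mult.assoc)
qed

text \<open>Here \<open>z * (exp (expo z) - 1)\<close> is comparable to
  \<open>z * expo z = exp (- z)\<close> and has modulus at most 3/4. So at least a quarter of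
  \<open>Re z\<close> survives, which the factor \<open>c \<ge> 8\<close> turns into
  doubling.\<close>

lemma Re_f_lam_half_plane:
  assumes "c \<ge> 8" "Re z \<ge> 1"
  shows "Re (f_lam c z) \<ge> 2 * Re z"
proof -
  have e: "exp (- 1) \<le> (1/2::real)"
    using exp_ge_add_one_self[of "1::real"] by (simp add: exp_minus field_simps)
  have x: "exp (- Re z) \<le> 1/2"
    using e assms by (meson exp_le_cancel_iff neg_le_iff_le order_trans)
  have z: "cmod z \<ge> 1" "z \<noteq> 0"
    using assms complex_Re_le_cmod[of z] by auto
  have "cmod (expo z) \<le> exp (- Re z)"
    using z by (simp add: norm_expo divide_le_eq mult_le_cancel_left1)
  with x have "cmod (exp (expo z) - 1) \<le> 3/2 * cmod (expo z)"
    by (intro norm_exp_bounds) auto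
  then have "cmod z * cmod (exp (expo z) - 1) \<le> cmod z * (3/2 * cmod (expo z))"
    by (intro mult_left_mono) auto
  also have "\<dots> = 3/2 * exp (- Re z)"
    using z by (simp add: norm_expo)
  also have "\<dots> \<le> 3/4"
    using x by simp
  finally have "cmod (z * exp (expo z) - z) \<le> 3/4"
    by (simp add: norm_mult[symmetric] algebra_simps)
  then have "Re z - Re (z * exp (expo z)) \<le> 3/4"
    using complex_Re_le_cmod[of "z - z * exp (expo z)"] by (simp add: norm_minus_commute)
  then have "Re (z * exp (expo z)) \<ge> Re z / 4"
    using assms by simp
  then have "c * Re (z * exp (expo z)) \<ge> 8 * (Re z / 4)"
    using assms by (intro mult_mono) auto
  moreover have "Re (f_lam c z) = c * Re (z * exp (expo z))"
    unfolding f_lam_expo mult.assoc by simp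
  ultimately show ?thesis by simp
qed

lemma f_lam_haven:
  assumes "c \<ge> 8" "z \<in> haven"
  shows "Re (f_lam c z) \<ge> 2" "f_lam c z \<in> haven"
proof -
  show *: "Re (f_lam c z) \<ge> 2"
  proof (cases "Re z \<ge> 1")
    case True
    then show ?thesis using Re_f_lam_half_plane[OF assms(1)] by force
  next
    case False
    then have "z = of_real (Re z)" "Re z > 0"
      using assms by (auto simp: haven_def complex_eq_iff)
    then show ?thesis using f_lam_positive_real(2)[of c "Re z"] assms by simp
  qed
  then show "f_lam c z \<in> haven" by (simp add: haven_def)
qed

lemma iterate_f_lam_haven:
  assumes "c \<ge> 8" "z \<in> haven"
  shows "(f_lam c ^^ n) z \<in> haven" "Re ((f_lam c ^^ Suc n) z) \<ge> 2 ^ Suc n"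
proof -
  show "(f_lam c ^^ n) z \<in> haven" for n
    by (induction n) (use assms f_lam_haven in auto)
  show "Re ((f_lam c ^^ Suc n) z) \<ge> 2 ^ Suc n"
  proof (induction n)
    case 0
    then show ?case using f_lam_haven(1)[OF assms] by simp
  next
    case (Suc n)
    have "Re ((f_lam c ^^ Suc n) z) \<ge> 1"
      using Suc one_le_power[of 2 "Suc n"] by (meson order_trans one_le_numeral)
    from Re_f_lam_half_plane[OF assms(1) this] Suc show ?case by simp
  qed
qed

section \<open>Variation of arguments along a curve\<close>

lemma arg_window:
  fixes \<psi> :: "real \<Rightarrow> real"
  assumes "continuous_on {s..t} \<psi>" "u \<in> {s..t}" "v \<in> {s..t}"
    and "\<And>w. w \<in> {s..t} \<Longrightarrow> cos (\<psi> w) \<noteq> - 1"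
  shows "\<bar>\<psi> u - \<psi> v\<bar> < 2 * pi"
proof (rule ccontr)
  assume neg: "\<not> \<bar>\<psi> u - \<psi> v\<bar> < 2 * pi"
  define lo hi where "lo = min (\<psi> u) (\<psi> v)" and "hi = max (\<psi> u) (\<psi> v)"
  have len: "hi - lo \<ge> 2 * pi" using neg by (auto simp: lo_def hi_def)
  \<comment> \<open>\<open>y\<close> is the least odd multiple of \<open>pi\<close> that is at least
    \<open>lo\<close>. A variation of \<open>2 * pi\<close> would force this value to be attained,
    and there the cosine is -1.\<close>
  define k where "k = \<lceil>(lo - pi) / (2 * pi)\<rceil>"
  define y where "y = pi + 2 * pi * real_of_int k"
  have "(lo - pi) / (2 * pi) \<le> k" "k < (lo - pi) / (2 * pi) + 1"
    unfolding k_def by linarith+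
  then have "lo \<le> y" "y \<le> lo + 2 * pi"
    by (auto simp: y_def field_simps)
  then have "lo \<le> y" "y \<le> hi" using len by auto
  moreover have "connected (\<psi> ` {s..t})"
    using assms(1) by (intro connected_continuous_image) auto
  moreover have "lo \<in> \<psi> ` {s..t}" "hi \<in> \<psi> ` {s..t}"
    using assms by (auto simp: lo_def hi_def min_def max_def)
  ultimately have "y \<in> \<psi> ` {s..t}"
    unfolding connected_iff_interval by blast
  then obtain w where w: "w \<in> {s..t}" "\<psi> w = y" by auto
  have "cos y = - 1"
    using cos_int_2pin[of k] sin_int_2pin[of k] by (simp add: y_def cos_add)
  then show False using assms(4)[OF w(1)] w by simp
qed

text \<open>
  On such a curve the argument of \<^term>\<open>f_lam c (g u)\<close> has a continuous branch, which cannot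
  cross a value at which \<^term>\<open>f_lam c (g u)\<close> would be positive.
\<close>
lemma Im_expo_window:
  fixes g :: "real \<Rightarrow> complex"
  assumes c: "c > 0" and g: "continuous_on {s..t} g"
    and g0: "\<And>u. u \<in> {s..t} \<Longrightarrow> g u \<notin> \<real>\<^sub>\<ge>\<^sub>0"
    and fg: "\<And>u. u \<in> {s..t} \<Longrightarrow> f_lam c (g u) \<notin> \<real>\<^sub>\<ge>\<^sub>0"
    and uv: "u \<in> {s..t}" "v \<in> {s..t}"
  shows "\<bar>Im (expo (g u)) - Im (expo (g v))\<bar> < 4 * pi"
proof -
  \<comment> \<open>A continuous branch of the argument of \<open>- f_lam c (g u)\<close>; cosine -1
    would mean that \<open>f_lam c (g u)\<close> is positive.\<close>
  define \<psi> where "\<psi> = (\<lambda>u. Im (Ln (- g u)) + Im (expo (g u)))"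
  have nz: "g w \<noteq> 0" if "w \<in> {s..t}" for w
    using g0[OF that] by auto
  have np: "- g w \<notin> \<real>\<^sub>\<le>\<^sub>0" if "w \<in> {s..t}" for w
    using g0[OF that] by (simp add: complex_nonneg_Reals_iff complex_nonpos_Reals_iff)
  have cont: "continuous_on {s..t} \<psi>"
    unfolding \<psi>_def expo_def using np nz by (intro continuous_intros g) auto
  have "cos (\<psi> w) \<noteq> - 1" if w: "w \<in> {s..t}" for w
  proof
    assume *: "cos (\<psi> w) = - 1"
    then have "sin (\<psi> w) = 0"
      using sin_cos_squared_add[of "\<psi> w"] by simp
    with * have "cis (\<psi> w) = - 1" by (simp add: complex_eq_iff)
    moreover have "f_lam c (g w) = - (of_real c * exp (Ln (- g w)) * exp (expo (g w)))"
      using nz[OF w] by (simp add: f_lam_expo)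
    then have "f_lam c (g w) = - (of_real c * exp (Ln (- g w) + expo (g w)))"
      by (simp add: exp_add)
    then have "f_lam c (g w) = - (of_real c * of_real (exp (Re (Ln (- g w) + expo (g w)))) * cis (\<psi> w))"
      by (simp add: exp_eq_polar \<psi>_def)
    ultimately have "f_lam c (g w) = of_real (c * exp (Re (Ln (- g w) + expo (g w))))"
      by simp
    then have "f_lam c (g w) \<in> \<real>\<^sub>\<ge>\<^sub>0" using c by simp
    then show False using fg[OF w] by simp
  qed
  from arg_window[OF cont uv this]
  have "\<bar>\<psi> u - \<psi> v\<bar> < 2 * pi" .
  \<comment> \<open>The principal argument of \<open>- g\<close> stays in an interval of length
    \<open>2 * pi\<close>; this is the second half of the bound \<open>4 * pi\<close>.\<close>
  moreover have "\<bar>Im (Ln (- g u)) - Im (Ln (- g v))\<bar> < 2 * pi"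
    using Im_Ln_less_pi mpi_less_Im_Ln np nz uv
    by (smt (verit) Im_Ln_le_pi neg_equal_0_iff_equal)
  ultimately show ?thesis unfolding \<psi>_def by linarith
qed

section \<open>Crossings of logarithmic annuli\<close>

lemma not_haven_nonneg: "z \<noteq> 0 \<Longrightarrow> z \<notin> haven \<Longrightarrow> z \<notin> \<real>\<^sub>\<ge>\<^sub>0"
  by (auto simp: haven_def complex_nonneg_Reals_iff complex_eq_iff)

text \<open>The absolute value treats annuli near 0 and near infinity alike. The width 10 makes the
  ratio of the radii \<open>exp 10\<close>, large enough to absorb the constant factors lost
  later.\<close>

definition crossing :: "(real \<Rightarrow> complex) \<Rightarrow> real \<Rightarrow> real \<Rightarrow> real \<Rightarrow> bool" where
  "crossing h s t l \<longleftrightarrow> s \<le> t \<and> continuous_on {s..t} h \<and>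
     (\<forall>u\<in>{s..t}. l \<le> lnorm (h u) \<and> lnorm (h u) \<le> l + 10) \<and>
     (\<exists>u\<in>{s..t}. lnorm (h u) = l) \<and> (\<exists>u\<in>{s..t}. lnorm (h u) = l + 10)"

text \<open>Stop at the first time \<open>v'\<close> with \<open>k \<ge> q\<close>, then go back to
  the last time \<open>u'\<close> before it with \<open>k \<le> p\<close>.\<close>

lemma subinterval_between_aux:
  fixes k :: "real \<Rightarrow> real"
  assumes k: "continuous_on {u..v} k" and "u \<le> v" "k u \<le> p" "p \<le> q" "q \<le> k v"
  shows "\<exists>u' v'. u \<le> u' \<and> u' \<le> v' \<and> v' \<le> v \<and> k ` {u'..v'} \<subseteq> {p..q} \<and> k u' = p \<and> k v' = q"
proof -
  define S where "S = {w \<in> {u..v}. q \<le> k w}"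
  have "compact S"
    unfolding S_def using k by (intro compact_eq_bounded_closed[THEN iffD2] conjI
      continuous_on_closed_Collect_le) (auto intro: bounded_subset[of "{u..v}"] continuous_intros)
  moreover have "v \<in> S" using assms by (auto simp: S_def)
  ultimately obtain v' where v': "v' \<in> S" "\<And>w. w \<in> S \<Longrightarrow> v' \<le> w"
    using compact_attains_inf[of S] by blast
  have kv: "k v' = q"
  proof -
    have "\<exists>w. u \<le> w \<and> w \<le> v' \<and> k w = q"
      using v'(1) assms k by (intro IVT') (auto simp: S_def intro: continuous_on_subset)
    then obtain w where w: "u \<le> w" "w \<le> v'" "k w = q" by blast
    then have "w \<in> S" using v'(1) by (auto simp: S_def)
    with v'(2) w show ?thesis by force
  qed
  define T where "T = {w \<in> {u..v'}. k w \<le> p}"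
  have kv': "continuous_on {u..v'} k"
    using v'(1) k by (auto simp: S_def intro: continuous_on_subset)
  have "compact T"
    unfolding T_def using kv' by (intro compact_eq_bounded_closed[THEN iffD2] conjI
      continuous_on_closed_Collect_le) (auto intro: bounded_subset[of "{u..v'}"] continuous_intros)
  moreover have "u \<in> T" using assms v'(1) by (auto simp: T_def S_def)
  ultimately obtain u' where u': "u' \<in> T" "\<And>w. w \<in> T \<Longrightarrow> w \<le> u'"
    using compact_attains_sup[of T] by blast
  have ku: "k u' = p"
  proof -
    have "\<exists>w. u' \<le> w \<and> w \<le> v' \<and> k w = p"
      using u'(1) assms kv kv' by (intro IVT') (auto simp: T_def intro: continuous_on_subset)
    then obtain w where w: "u' \<le> w" "w \<le> v'" "k w = p" by blast
    then have "w \<in> T" using u'(1) by (auto simp: T_def)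
    with u'(2) w show ?thesis by force
  qed
  have "p \<le> k w \<and> k w \<le> q" if w: "w \<in> {u'..v'}" for w
  proof
    show "p \<le> k w"
    proof (rule ccontr)
      assume "\<not> p \<le> k w"
      then have "w \<in> T" using w u'(1) by (auto simp: T_def)
      then have "w = u'" using u'(2) w by force
      then show False using ku \<open>\<not> p \<le> k w\<close> by simp
    qed
    show "k w \<le> q"
    proof (rule ccontr)
      assume "\<not> k w \<le> q"
      then have "w \<in> S" using w u'(1) v'(1) by (auto simp: T_def S_def)
      then have "w = v'" using v'(2) w by force
      then show False using kv \<open>\<not> k w \<le> q\<close> by simp
    qed
  qed
  moreover have "u \<le> u'" "u' \<le> v'" "v' \<le> v" using u'(1) v'(1) by (auto simp: T_def S_def)
  ultimately show ?thesis using ku kv by (intro exI[of _ u'] exI[of _ v']) auto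
qed

lemma subinterval_between:
  fixes k :: "real \<Rightarrow> real"
  assumes k: "continuous_on {s..t} k" and uv: "u \<in> {s..t}" "v \<in> {s..t}"
    and "k u \<le> p" "p \<le> q" "q \<le> k v"
  shows "\<exists>s' t'. s \<le> s' \<and> s' \<le> t' \<and> t' \<le> t \<and> k ` {s'..t'} \<subseteq> {p..q} \<and>
           (\<exists>u'\<in>{s'..t'}. k u' = p) \<and> (\<exists>v'\<in>{s'..t'}. k v' = q)"
proof (cases "u \<le> v")
  case True
  have "continuous_on {u..v} k"
    using k by (rule continuous_on_subset) (use uv in auto)
  from subinterval_between_aux[OF this True assms(4-6)]
  obtain u' v' where "u \<le> u'" "u' \<le> v'" "v' \<le> v" "k ` {u'..v'} \<subseteq> {p..q}" "k u' = p" "k v' = q"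
    by blast
  then show ?thesis using uv by (intro exI[of _ u'] exI[of _ v']) auto
next
  case False
  \<comment> \<open>If the larger value comes first, the curve is run backwards.\<close>
  have "continuous_on {-u..-v} (\<lambda>w. k (- w))"
    by (rule continuous_on_compose2[OF k]) (use uv in \<open>auto intro: continuous_intros\<close>)
  from subinterval_between_aux[OF this _ _ assms(5)]
  obtain u' v' where *: "-u \<le> u'" "u' \<le> v'" "v' \<le> -v" "(\<lambda>w. k (- w)) ` {u'..v'} \<subseteq> {p..q}"
      "k (- u') = p" "k (- v') = q"
    using False assms(4,6) by force
  have "k w \<in> {p..q}" if "w \<in> {-v'..-u'}" for w
    using *(4) that by (auto simp: image_subset_iff dest!: bspec[of _ _ "- w"])
  then show ?thesis using uv *
    by (intro exI[of _ "-v'"] exI[of _ "-u'"]) auto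
qed

lemma continuous_on_lnorm:
  assumes "continuous_on S h" "\<And>u. u \<in> S \<Longrightarrow> h u \<noteq> 0"
  shows "continuous_on S (\<lambda>u. lnorm (h u))"
  using assms by (intro continuous_intros) auto

lemma crossing_between:
  assumes h: "continuous_on {s..t} h" "\<And>u. u \<in> {s..t} \<Longrightarrow> h u \<noteq> 0"
    and uv: "u \<in> {s..t}" "v \<in> {s..t}" "lnorm (h u) \<le> l" "l + 10 \<le> lnorm (h v)"
  shows "\<exists>s' t'. s \<le> s' \<and> t' \<le> t \<and> crossing h s' t' l"
proof -
  from subinterval_between[OF continuous_on_lnorm[OF h] uv(1,2,3) _ uv(4)]
  obtain s' t' where *: "s \<le> s'" "s' \<le> t'" "t' \<le> t"
    "(\<lambda>u. lnorm (h u)) ` {s'..t'} \<subseteq> {l..l + 10}"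
    "\<exists>u'\<in>{s'..t'}. lnorm (h u') = l" "\<exists>v'\<in>{s'..t'}. lnorm (h v') = l + 10"
    by auto
  have "continuous_on {s'..t'} h"
    using h(1) by (rule continuous_on_subset) (use * in auto)
  then show ?thesis using *
    by (intro exI[of _ s'] exI[of _ t']) (auto simp: crossing_def image_subset_iff)
qed

lemma crossing_nonzero:
  assumes "crossing h s t l" "l > 0" "u \<in> {s..t}"
  shows "h u \<noteq> 0"
proof -
  have "l \<le> lnorm (h u)" using assms by (simp add: crossing_def)
  with assms(2) show ?thesis by auto
qed

lemma continuous_on_f_lam:
  assumes "continuous_on S h" "\<And>u. u \<in> S \<Longrightarrow> h u \<noteq> 0"
  shows "continuous_on S (\<lambda>u. f_lam c (h u))"
  unfolding f_lam_def using assms by (intro continuous_intros) auto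

lemma continuous_on_expo:
  assumes "continuous_on S h" "\<And>u. u \<in> S \<Longrightarrow> h u \<noteq> 0"
  shows "continuous_on S (\<lambda>u. expo (h u))"
  unfolding expo_def using assms by (intro continuous_intros) auto

text \<open>The window keeps \<open>Im (expo (h v))\<close> within \<open>2 * a\<close>, because
  \<open>4 * pi \<le> a\<close>; so the real part at \<open>v\<close> is at least
  \<open>8 * a\<close> in absolute value, while at \<open>u\<close> it is at most \<open>a\<close>.
  By \<open>ln_norm_f_lam\<close> the value \<open>lnorm\<close> of the image is then at most
  \<open>2 * a\<close> at \<open>u\<close> and at least \<open>7 * a\<close> at \<open>v\<close>,
  which leaves room for a crossing.\<close>

lemma crossing_expo_ratio:
  assumes c: "c \<ge> 1" and h: "crossing h s t l" "l \<ge> 40"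
    and avoid: "\<And>u. u \<in> {s..t} \<Longrightarrow> h u \<notin> haven" "\<And>u. u \<in> {s..t} \<Longrightarrow> f_lam c (h u) \<notin> haven"
    and uv: "u \<in> {s..t}" "v \<in> {s..t}" and a: "a \<ge> l + 10 + ln c"
    and A: "cmod (expo (h u)) \<le> a" "cmod (expo (h v)) \<ge> 10 * a"
  shows "\<exists>s' t'. s \<le> s' \<and> t' \<le> t \<and> crossing (\<lambda>u. f_lam c (h u)) s' t' (2 * a)"
proof -
  have hc: "continuous_on {s..t} h" using h by (simp add: crossing_def)
  have nz: "h w \<noteq> 0" if "w \<in> {s..t}" for w
    using crossing_nonzero[OF h(1) _ that] h(2) by simp
  have fnz: "f_lam c (h w) \<noteq> 0" if "w \<in> {s..t}" for w
    using nz[OF that] c by (simp add: f_lam_eq_0_iff)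
  have "\<bar>Im (expo (h u)) - Im (expo (h v))\<bar> < 4 * pi"
    using Im_expo_window[OF _ hc _ _ uv, of c] c not_haven_nonneg nz fnz avoid by auto
  moreover have L: "ln c \<ge> 0" using c by simp
  moreover have "4 * pi \<le> a" using pi_less_4 a h(2) L by linarith
  ultimately have "\<bar>Im (expo (h v))\<bar> \<le> 2 * a"
    using A(1) abs_Im_le_cmod[of "expo (h u)"] by linarith
  then have Rv: "\<bar>Re (expo (h v))\<bar> \<ge> 8 * a"
    using A(2) cmod_le[of "expo (h v)"] by linarith
  have Ru: "\<bar>Re (expo (h u))\<bar> \<le> a"
    using A(1) abs_Re_le_cmod[of "expo (h u)"] by linarith
  have ln: "ln (cmod (f_lam c (h w))) = ln (cmod (h w)) + ln c + Re (expo (h w))" if "w \<in> {s..t}" for w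
    using c nz[OF that] by (intro ln_norm_f_lam) auto
  have b: "lnorm (h w) \<le> l + 10" if "w \<in> {s..t}" for w
    using h that by (simp add: crossing_def)
  have "lnorm (f_lam c (h u)) \<le> 2 * a"
    using ln[OF uv(1)] b[OF uv(1)] Ru a L by linarith
  moreover have "2 * a + 10 \<le> lnorm (f_lam c (h v))"
    using ln[OF uv(2)] b[OF uv(2)] Rv a L h(2) by linarith
  ultimately show ?thesis
    using crossing_between[OF continuous_on_f_lam[OF hc nz] fnz uv] by blast
qed

text \<open>To change sign, \<open>ln (cmod (h u))\<close> would have to pass 0, but its absolute
  value never drops below \<open>l\<close>.\<close>

lemma crossing_sign:
  assumes h: "crossing h s t l" "l > 0"
  shows "(\<forall>u\<in>{s..t}. ln (cmod (h u)) \<ge> l) \<or> (\<forall>u\<in>{s..t}. ln (cmod (h u)) \<le> - l)"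
proof (rule ccontr)
  assume "\<not> ?thesis"
  then obtain u v where uv: "u \<in> {s..t}" "v \<in> {s..t}" "ln (cmod (h u)) < l" "ln (cmod (h v)) > - l"
    by force
  have l: "lnorm (h w) \<ge> l" if "w \<in> {s..t}" for w
    using h that by (simp add: crossing_def)
  have hc: "continuous_on {s..t} (\<lambda>u. ln (cmod (h u)))"
    using h crossing_nonzero[OF h] by (intro continuous_intros) (auto simp: crossing_def)
  have "ln (cmod (h u)) \<le> 0" "0 \<le> ln (cmod (h v))"
    using uv l[OF uv(1)] l[OF uv(2)] h(2) by linarith+
  then have "\<exists>w\<in>{s..t}. ln (cmod (h w)) = 0"
    using subinterval_between[OF hc uv(1,2), of 0 0] by fastforce
  with l h(2) show False by force
qed

section \<open>Crossings close to 0\<close>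

lemma expo_near_0:
  assumes "ln (cmod z) \<le> - 1" "z \<noteq> 0"
  shows "cmod (expo z) \<le> 2 * exp (- ln (cmod z))" "cmod (expo z) \<ge> exp (- ln (cmod z)) / 2"
proof -
  have "exp (- 1) \<le> (1/2::real)"
    using exp_ge_add_one_self[of "1::real"] by (simp add: exp_minus field_simps)
  moreover have "cmod z = exp (ln (cmod z))" using assms by simp
  then have "cmod z \<le> exp (- 1)" using assms(1) exp_le_cancel_iff by metis
  ultimately have "cmod z \<le> 1/2" by linarith
  then have "\<bar>Re z\<bar> \<le> 1/2" using abs_Re_le_cmod[of z] by linarith
  then have "exp (- Re z) \<le> exp (1/2)" "exp (-(1/2)) \<le> exp (- Re z)" by auto
  moreover have "exp (1/2) \<le> (2::real)"
    using exp_bound_half[of "1/2::real"] by simp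
  moreover from this have "exp (-(1/2)) \<ge> (1/2::real)"
    by (simp add: exp_minus field_simps)
  ultimately have "exp (- Re z) \<le> 2" "1/2 \<le> exp (- Re z)" by linarith+
  then show "cmod (expo z) \<le> 2 * exp (- ln (cmod z))" "cmod (expo z) \<ge> exp (- ln (cmod z)) / 2"
    using assms by (auto simp: norm_expo exp_minus divide_simps)
qed

text \<open>Close to 0 the modulus of \<open>expo z\<close> is \<open>1 / cmod z\<close> up to a
  factor 2. As \<open>exp 10 \<ge> 40\<close>, it varies by a factor of at least 10 across the
  annulus, and \<open>crossing_expo_ratio\<close> applies with \<open>a = 2 * exp l\<close>.\<close>

lemma crossing_step_near_0:
  assumes c: "c \<ge> 1" and h: "crossing h s t l" "l \<ge> ln c + 100"
    and avoid: "\<And>u. u \<in> {s..t} \<Longrightarrow> h u \<notin> haven" "\<And>u. u \<in> {s..t} \<Longrightarrow> f_lam c (h u) \<notin> haven"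
    and neg: "\<And>u. u \<in> {s..t} \<Longrightarrow> ln (cmod (h u)) \<le> - l"
  shows "\<exists>s' t' l'. s \<le> s' \<and> t' \<le> t \<and> l + 1 \<le> l' \<and> crossing (\<lambda>u. f_lam c (h u)) s' t' l'"
proof -
  have L: "ln c \<ge> 0" using c by simp
  obtain u v where uv: "u \<in> {s..t}" "v \<in> {s..t}" "lnorm (h u) = l" "lnorm (h v) = l + 10"
    using h(1) by (auto simp: crossing_def)
  have lu: "ln (cmod (h u)) = - l" "ln (cmod (h v)) = - (l + 10)"
    using uv neg[OF uv(1)] neg[OF uv(2)] L h(2) by linarith+
  have nz: "h u \<noteq> 0" "h v \<noteq> 0"
    using crossing_nonzero[OF h(1)] uv h(2) L by force+
  have e: "exp (10::real) \<ge> 40"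
    using exp_lower_Taylor_quadratic[of "10::real"] by simp
  have "cmod (expo (h u)) \<le> 2 * exp l"
    using expo_near_0(1)[OF _ nz(1)] lu h(2) L by simp
  moreover have "cmod (expo (h v)) \<ge> exp (l + 10) / 2"
    using expo_near_0(2)[OF _ nz(2)] lu h(2) L by (simp add: add.commute)
  then have "cmod (expo (h v)) \<ge> exp l * exp 10 / 2" by (simp only: exp_add)
  then have "cmod (expo (h v)) \<ge> 10 * (2 * exp l)"
    using mult_left_mono[OF e exp_ge_zero[of l]] by linarith
  moreover have "exp l \<ge> 1 + l" by simp
  then have "2 * exp l \<ge> l + 10 + ln c" using h(2) L by linarith
  ultimately obtain s' t' where "s \<le> s'" "t' \<le> t" "crossing (\<lambda>u. f_lam c (h u)) s' t' (2 * (2 * exp l))"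
    using crossing_expo_ratio[OF c h(1) _ avoid uv(1,2)] h(2) L by (smt (verit, best))
  moreover have "l + 1 \<le> 2 * (2 * exp l)" using \<open>exp l \<ge> 1 + l\<close> h(2) L by linarith
  ultimately show ?thesis by blast
qed

section \<open>Crossings close to infinity: horizontal strips\<close>

lemma attains_between:
  fixes k :: "real \<Rightarrow> real"
  assumes "continuous_on {s..t} k" "u \<in> {s..t}" "v \<in> {s..t}" "k u \<le> p" "p \<le> k v"
  shows "\<exists>w\<in>{s..t}. k w = p"
proof -
  have "connected (k ` {s..t})"
    using assms(1) by (intro connected_continuous_image) auto
  then have "p \<in> k ` {s..t}"
    using assms(2-5) unfolding connected_iff_interval by blast
  then show ?thesis by auto
qed

lemma arctan_le_self: 
  assumes "0 \<le> (x::real)" shows "arctan x \<le> x"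
proof -
  have "\<bar>arctan x\<bar> \<le> \<bar>tan (arctan x)\<bar>"
    using arctan_bounded[of x] by (intro abs_tan_ge) auto
  then show ?thesis using assms by (simp add: tan_arctan)
qed

text \<open>For \<^term>\<open>z\<close> in the upper half-plane this is the argument of \<^term>\<open>f_lam c z\<close> minus a quarter turn.\<close>
definition turn :: "complex \<Rightarrow> real" where
  "turn z = arctan (- Re z / Im z) + Im (expo z)"

lemma Re_f_lam_turn:
  assumes "c > 0" "Im z > 0"
  shows "Re (f_lam c z) = - cmod (f_lam c z) * sin (turn z)"
proof -
  have *: "Im (Ln (- \<i> * z)) = arctan (- Re z / Im z)"
    using Im_Ln_eq[of "- \<i> * z"] assms by (auto simp: complex_eq_iff)
  have "z \<noteq> 0" using assms by auto
  then have "f_lam c z = of_real c * (\<i> * exp (Ln (- \<i> * z))) * exp (expo z)"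
    by (simp add: f_lam_expo)
  also have "\<dots> = of_real c * \<i> * exp (Ln (- \<i> * z) + expo z)"
    by (simp add: exp_add)
  finally have eq: "f_lam c z = of_real c * \<i> * exp (Ln (- \<i> * z) + expo z)" .
  have "cmod (f_lam c z) = c * exp (Re (Ln (- \<i> * z) + expo z))"
    unfolding eq using assms by (simp add: norm_mult)
  moreover have "Im (Ln (- \<i> * z) + expo z) = turn z"
    using * by (simp add: turn_def)
  moreover have "Re (f_lam c z) = - c * exp (Re (Ln (- \<i> * z) + expo z)) * sin (Im (Ln (- \<i> * z) + expo z))"
    unfolding eq by (simp add: Re_exp Im_exp)
  ultimately show ?thesis by simp
qed

lemma expo_explicit:
  "Re (expo z) = exp (- Re z) / (cmod z)\<^sup>2 * (Re z * cos (Im z) - Im z * sin (Im z))"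
  "Im (expo z) = - exp (- Re z) / (cmod z)\<^sup>2 * (Im z * cos (Im z) + Re z * sin (Im z))"
proof -
  have "expo z = exp (- z) * cnj z / (cmod z)\<^sup>2"
    unfolding expo_def by (rule complex_div_cnj)
  then show "Re (expo z) = exp (- Re z) / (cmod z)\<^sup>2 * (Re z * cos (Im z) - Im z * sin (Im z))"
    "Im (expo z) = - exp (- Re z) / (cmod z)\<^sup>2 * (Im z * cos (Im z) + Re z * sin (Im z))"
    by (simp_all add: Re_divide_of_real Im_divide_of_real Re_exp Im_exp algebra_simps add_divide_distrib diff_divide_distrib
         flip: of_real_power)
qed

text \<open>At even multiples of \<open>pi\<close> the imaginary part of \<open>expo z\<close> is
  negative and outweighs the arctangent. For \<open>Re z \<le> 0\<close> put
  \<open>t = - Re z\<close>: the arctangent is at most \<open>t / Im z\<close>, and the quadratic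
  Taylor bound for \<open>exp t\<close> makes the other term at least
  \<open>(t + 1/2) / Im z\<close> in size. For \<open>0 < Re z < 1\<close> the arctangent is already
  nonpositive.\<close>

lemma turn_top:
  assumes "cos (Im z) = 1" "Re z < 1" "Im z \<ge> 2" "2 * \<bar>Re z\<bar> + 1 \<le> (Im z)\<^sup>2"
  shows "turn z \<le> - (1 / (4 * Im z))"
proof -
  define x y where "x = Re z" and "y = Im z"
  have y: "y \<ge> 2" "x < 1" "2 * \<bar>x\<bar> + 1 \<le> y\<^sup>2" using assms by (auto simp: x_def y_def)
  have "sin (Im z) = 0" using assms(1) sin_cos_squared_add[of "Im z"] by simp
  with assms have A: "Im (expo z) = - (exp (- x) * y / (x\<^sup>2 + y\<^sup>2))"
    by (simp add: expo_explicit x_def y_def cmod_def)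
  have pos: "x\<^sup>2 + y\<^sup>2 > 0" using y by (intro add_nonneg_pos) auto
  have div: "a / y \<le> exp (- x) * y / (x\<^sup>2 + y\<^sup>2)" if "a * (x\<^sup>2 + y\<^sup>2) \<le> exp (- x) * y\<^sup>2" for a
  proof -
    have "a / y = a * (x\<^sup>2 + y\<^sup>2) / (y * (x\<^sup>2 + y\<^sup>2))" using pos y by simp
    also have "\<dots> \<le> exp (- x) * y\<^sup>2 / (y * (x\<^sup>2 + y\<^sup>2))"
      using that pos y by (intro divide_right_mono) auto
    also have "\<dots> = exp (- x) * y / (x\<^sup>2 + y\<^sup>2)" using y by (simp add: power2_eq_square)
    finally show ?thesis .
  qed
  show ?thesis
  proof (cases "x \<le> 0")
    case True
    define t where "t = - x"
    have t: "t \<ge> 0" "2 * t + 1 \<le> y\<^sup>2" using True y by (auto simp: t_def)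
    have tx: "- x = t" "x\<^sup>2 = t\<^sup>2" by (simp_all add: t_def)
    have "exp t \<ge> 1 + t + t\<^sup>2/2" using t by (intro exp_lower_Taylor_quadratic)
    then have "exp t * y\<^sup>2 \<ge> (1 + t + t\<^sup>2/2) * y\<^sup>2" by (intro mult_right_mono) auto
    moreover have "(1 + t + t\<^sup>2/2) * y\<^sup>2 - (t + 1/2) * (t\<^sup>2 + y\<^sup>2) = y\<^sup>2 / 2 + t\<^sup>2 / 2 * (y\<^sup>2 - (2 * t + 1))"
      by (simp add: field_simps power2_eq_square)
    moreover have "t\<^sup>2 / 2 * (y\<^sup>2 - (2 * t + 1)) \<ge> 0" using t by (intro mult_nonneg_nonneg) auto
    moreover have "y\<^sup>2 / 2 \<ge> 0" by simp
    ultimately have "(t + 1/2) * (x\<^sup>2 + y\<^sup>2) \<le> exp (- x) * y\<^sup>2"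
      unfolding tx by linarith
    then have "(t + 1/2) / y \<le> exp (- x) * y / (x\<^sup>2 + y\<^sup>2)" by (rule div)
    moreover have "arctan (- x / y) \<le> t / y"
      using t y unfolding t_def by (intro arctan_le_self divide_nonneg_pos) auto
    moreover have "(t + 1/2) / y - t / y = 1 / (2 * y)" using y by (simp add: field_simps)
    moreover have "1 / (2 * y) \<ge> 1 / (4 * y)" using y by (simp add: field_simps)
    ultimately show ?thesis unfolding turn_def A x_def[symmetric] y_def[symmetric] by linarith
  next
    case False
    have "exp x \<le> 3" using y exp_le exp_le_cancel_iff[of x 1] by linarith
    then have "exp (- x) \<ge> 1/3" by (simp add: exp_minus field_simps)
    then have "exp (- x) * y\<^sup>2 \<ge> 1/3 * y\<^sup>2" by (intro mult_right_mono) auto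
    moreover have "x\<^sup>2 \<le> 1" using y False by (simp add: power_le_one)
    moreover have "y\<^sup>2 \<ge> 2\<^sup>2" using y by (intro power_mono) auto
    ultimately have "x\<^sup>2 + y\<^sup>2 \<le> 4 * (exp (- x) * y\<^sup>2)" by simp
    then have "1 / 4 / y \<le> exp (- x) * y / (x\<^sup>2 + y\<^sup>2)" by (intro div) simp
    then have "1 / (4 * y) \<le> exp (- x) * y / (x\<^sup>2 + y\<^sup>2)" by simp
    moreover have "arctan (- x / y) \<le> 0" using y False by simp
    ultimately show ?thesis unfolding turn_def A x_def[symmetric] y_def[symmetric] by linarith
  qed
qed

text \<open>At odd multiples of \<open>pi\<close> the imaginary part of \<open>expo z\<close> is
  nonnegative, so the lower bound of the arctangent decides.\<close>

lemma turn_bottom: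
  assumes "cos (Im z) = - 1" "Im z > 0"
  shows "turn z > - pi / 2"
proof -
  have "sin (Im z) = 0" using assms(1) sin_cos_squared_add[of "Im z"] by simp
  with assms have "Im (expo z) \<ge> 0" by (simp add: expo_explicit)
  then show ?thesis using arctan_lbound[of "- Re z / Im z"] unfolding turn_def by linarith
qed

lemma sin_ge_half:
  assumes "0 \<le> x" "x \<le> (1::real)"
  shows "sin x \<ge> x / 2"
proof -
  have "\<bar>sin x - (\<Sum>m<3. sin_coeff m * x ^ m)\<bar> \<le> inverse (fact 3) * \<bar>x\<bar> ^ 3"
    by (rule Maclaurin_sin_bound)
  moreover have "(\<Sum>m<3. sin_coeff m * x ^ m) = x"
    by (simp add: eval_nat_numeral sin_coeff_def)
  moreover have "inverse (fact 3) = (1 / 6 :: real)"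
    by (simp add: fact_numeral)
  ultimately have "\<bar>sin x - x\<bar> \<le> x ^ 3 / 6"
    using assms by simp
  moreover have "x ^ 3 \<le> x" using power_decreasing[of 1 3 x] assms by simp
  ultimately show ?thesis by linarith
qed

lemma norm_f_lam_strip:
  assumes "c > 0" "z \<noteq> 0" "Re (expo z) \<ge> - 1"
  shows "cmod (f_lam c z) \<ge> c * cmod z / 3"
proof -
  have "exp (Re (expo z)) \<ge> exp (- 1)" using assms by simp
  moreover have "exp (- 1) \<ge> (1/3::real)" using exp_le by (simp add: exp_minus field_simps)
  ultimately have "exp (Re (expo z)) \<ge> 1/3" by linarith
  then have "c * cmod z * exp (Re (expo z)) \<ge> c * cmod z * (1/3)"
    using assms by (intro mult_left_mono) auto
  then show ?thesis using assms by (simp add: norm_f_lam)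
qed

text \<open>
  While \<^term>\<open>Im z\<close> increases from an odd to the next even multiple of \<^term>\<open>pi\<close>,
  \<^term>\<open>turn z\<close> decreases through \<^term>\<open>- pi / 2\<close>, where \<^term>\<open>f_lam c z\<close> is a large positive real.
\<close>
lemma no_strip_crossing:
  fixes h :: "real \<Rightarrow> complex"
  assumes c: "c \<ge> 100" and h: "continuous_on {s..t} h"
    and avoid: "\<And>u. u \<in> {s..t} \<Longrightarrow> h u \<notin> haven" "\<And>u. u \<in> {s..t} \<Longrightarrow> f_lam c (h u) \<notin> haven"
    and im: "\<And>u. u \<in> {s..t} \<Longrightarrow> Im (h u) \<ge> 2" "\<And>u. u \<in> {s..t} \<Longrightarrow> 2 * \<bar>Re (h u)\<bar> + 1 \<le> (Im (h u))\<^sup>2"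
    and A: "\<And>u. u \<in> {s..t} \<Longrightarrow> cmod (expo (h u)) * \<bar>Re (h u)\<bar> \<le> cmod (h u)"
    and uv: "u \<in> {s..t}" "v \<in> {s..t}" "Im (h u) + 4 * pi \<le> Im (h v)"
  shows False
proof -
  \<comment> \<open>\<open>y\<close> is the least even multiple of \<open>pi\<close> with
    \<open>y - pi \<ge> Im (h u)\<close>. It is less than \<open>3 * pi\<close> above
    \<open>Im (h u)\<close>, so the whole strip from \<open>y - pi\<close> to \<open>y\<close> is
    crossed.\<close>
  define k where "k = \<lceil>(Im (h u) + pi) / (2 * pi)\<rceil>"
  define y where "y = 2 * pi * real_of_int k"
  have k: "(Im (h u) + pi) / (2 * pi) \<le> k" "k < (Im (h u) + pi) / (2 * pi) + 1"
    unfolding k_def by linarith+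
  then have y: "Im (h u) \<le> y - pi" "y \<le> Im (h v)"
    using uv by (auto simp: y_def field_simps)
  have ci: "continuous_on {s..t} (\<lambda>u. Im (h u))" using h by (intro continuous_intros)
  from subinterval_between[OF ci uv(1,2) y(1) _ y(2)]
  obtain s' t' u' v' where st: "s \<le> s'" "s' \<le> t'" "t' \<le> t"
    "(\<lambda>u. Im (h u)) ` {s'..t'} \<subseteq> {y - pi..y}"
    "u' \<in> {s'..t'}" "Im (h u') = y - pi" "v' \<in> {s'..t'}" "Im (h v') = y"
    by auto
  have sub: "w \<in> {s..t}" if "w \<in> {s'..t'}" for w using that st by auto
  have nz: "h w \<noteq> 0" if "w \<in> {s..t}" for w using im(1)[OF that] by auto
  have cosy: "cos y = 1" "sin y = 0"
    using cos_int_2pin[of k] sin_int_2pin[of k] by (auto simp: y_def)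
  \<comment> \<open>In this strip the sine of \<open>Im (h w)\<close> is nonpositive, so a negative
    contribution to \<open>Re (expo (h w))\<close> can come only from the term with
    \<open>Re (h w)\<close>, which the assumption \<open>A\<close> controls.\<close>
  have ReA: "Re (expo (h w)) \<ge> - 1" if w: "w \<in> {s'..t'}" for w
  proof -
    have "0 \<le> Im (h w) - (y - pi)" "Im (h w) - (y - pi) \<le> pi" using st(4) w by (auto simp: image_subset_iff)
    then have "sin (Im (h w) - (y - pi)) \<ge> 0" by (rule sin_ge_zero)
    then have "sin (Im (h w)) \<le> 0" by (simp add: sin_diff cos_diff cosy)
    then have "Im (h w) * sin (Im (h w)) \<le> 0"
      using im(1)[OF sub[OF w]] by (intro mult_nonneg_nonpos) auto
    moreover have "Re (h w) * cos (Im (h w)) \<ge> - \<bar>Re (h w)\<bar>"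
      using mult_left_mono[OF abs_cos_le_one[of "Im (h w)"], of "\<bar>Re (h w)\<bar>"]
      by (simp add: abs_mult[symmetric] abs_le_iff)
    ultimately have "Re (h w) * cos (Im (h w)) - Im (h w) * sin (Im (h w)) \<ge> - \<bar>Re (h w)\<bar>" by linarith
    then have "exp (- Re (h w)) / (cmod (h w))\<^sup>2 * (Re (h w) * cos (Im (h w)) - Im (h w) * sin (Im (h w)))
        \<ge> exp (- Re (h w)) / (cmod (h w))\<^sup>2 * (- \<bar>Re (h w)\<bar>)"
      by (intro mult_left_mono) auto
    then have "Re (expo (h w)) \<ge> - (cmod (expo (h w)) * \<bar>Re (h w)\<bar> / cmod (h w))"
      by (simp add: expo_explicit norm_expo power2_eq_square)
    moreover have "cmod (expo (h w)) * \<bar>Re (h w)\<bar> / cmod (h w) \<le> 1"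
      using A[OF sub[OF w]] nz[OF sub[OF w]] by simp
    ultimately show ?thesis by linarith
  qed
  have big: "cmod (f_lam c (h w)) \<ge> 33 * Im (h w)" if w: "w \<in> {s'..t'}" for w
  proof -
    have "cmod (f_lam c (h w)) \<ge> c * cmod (h w) / 3"
      using c nz[OF sub[OF w]] ReA[OF w] by (intro norm_f_lam_strip) auto
    moreover have "c * cmod (h w) \<ge> 100 * cmod (h w)" using c by (intro mult_right_mono) auto
    moreover have "cmod (h w) \<ge> Im (h w)" using abs_Im_le_cmod[of "h w"] by linarith 
    ultimately show ?thesis using im(1)[OF sub[OF w]] by linarith
  qed
  \<comment> \<open>The image avoids \<open>haven\<close> and therefore has real part below
    1.\<close>
  have sin: "cmod (f_lam c (h w)) * sin (turn (h w)) > - 1" if w: "w \<in> {s..t}" for w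
  proof -
    have "Re (f_lam c (h w)) < 1" using avoid(2)[OF w] by (auto simp: haven_def)
    then show ?thesis using Re_f_lam_turn[of c "h w"] c im(1)[OF w] by simp
  qed
  have "turn (h v') \<le> - (1 / (4 * y))"
    using turn_top[of "h v'"] st(7,8) im[OF sub[OF st(7)]] avoid(1)[OF sub[OF st(7)]] cosy
    by (auto simp: haven_def)
  \<comment> \<open>Otherwise \<open>turn (h v')\<close> lies between \<open>- pi / 2\<close> and
    \<open>- \<delta>\<close>, so its sine is at most \<open>- \<delta> / 2\<close>. Multiplied by a
    modulus of at least \<open>33 * y\<close> this gives at most \<open>- 33 / 8\<close>, against
    the bound -1.\<close>
  have "turn (h v') < - pi / 2"
  proof (rule ccontr)
    assume "\<not> turn (h v') < - pi / 2"
    define \<delta> where "\<delta> = 1 / (4 * y)"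
    have y2: "y \<ge> 2" using im(1)[OF sub[OF st(7)]] st(8) by simp
    have \<delta>: "0 \<le> \<delta>" "\<delta> \<le> 1" using y2 by (auto simp: \<delta>_def field_simps)
    have "sin (turn (h v')) \<le> sin (- \<delta>)"
      using \<open>\<not> turn (h v') < - pi / 2\<close> \<open>turn (h v') \<le> - (1 / (4 * y))\<close> \<delta>
      by (intro sin_monotone_2pi_le) (auto simp: \<delta>_def[symmetric] intro: order_trans[of _ 0])
    also have "\<dots> \<le> - (\<delta> / 2)" using sin_ge_half[OF \<delta>] by simp
    finally have s: "sin (turn (h v')) \<le> - (\<delta> / 2)" .
    have "cmod (f_lam c (h v')) * sin (turn (h v')) \<le> cmod (f_lam c (h v')) * (- (\<delta> / 2))"
      using s by (intro mult_left_mono) auto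
    also have "\<dots> \<le> 33 * y * (- (\<delta> / 2))"
      using big[OF st(7)] st(8) \<delta> by (intro mult_right_mono_neg) auto
    also have "\<dots> \<le> - 1" using y2 by (simp add: \<delta>_def)
    finally show False using sin[OF sub[OF st(7)]] by linarith
  qed
  moreover have "turn (h u') > - pi / 2"
    using turn_bottom[of "h u'"] st(5,6) im(1)[OF sub[OF st(5)]] cosy by (simp add: cos_diff)
  moreover have "continuous_on {s'..t'} (\<lambda>w. turn (h w))"
  proof -
    have hc: "continuous_on {s'..t'} h" using h by (rule continuous_on_subset) (use st in auto)
    have "Im (h w) \<noteq> 0" "h w \<noteq> 0" if "w \<in> {s'..t'}" for w
      using im(1)[OF sub[OF that]] by auto
    then show ?thesis
      unfolding turn_def by (intro continuous_intros continuous_on_expo hc) auto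
  qed
  ultimately have "\<exists>w\<in>{s'..t'}. turn (h w) = - pi / 2"
    by (intro attains_between[OF _ st(7,5)]) auto
  then obtain w where w: "w \<in> {s'..t'}" "turn (h w) = - pi / 2" by blast
  \<comment> \<open>Here the real part of the image equals its modulus, which is at least 66; so the
    image would lie in \<open>haven\<close>.\<close>
  have "sin (turn (h w)) = - 1" unfolding w(2) by simp
  then show False using sin[OF sub[OF w(1)]] big[OF w(1)] im(1)[OF sub[OF w(1)]] by simp
qed

lemma expo_cnj: "expo (cnj z) = cnj (expo z)"
  by (simp add: expo_def exp_cnj)

text \<open>The imaginary part does not vanish along the curve, so it has a constant sign, and
  conjugation reduces the lower half-plane to the upper one.\<close>

lemma no_strip_crossing_abs:
  fixes h :: "real \<Rightarrow> complex"
  assumes c: "c \<ge> 100" and h: "continuous_on {s..t} h"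
    and avoid: "\<And>u. u \<in> {s..t} \<Longrightarrow> h u \<notin> haven" "\<And>u. u \<in> {s..t} \<Longrightarrow> f_lam c (h u) \<notin> haven"
    and im: "\<And>u. u \<in> {s..t} \<Longrightarrow> \<bar>Im (h u)\<bar> \<ge> 2" "\<And>u. u \<in> {s..t} \<Longrightarrow> 2 * \<bar>Re (h u)\<bar> + 1 \<le> (Im (h u))\<^sup>2"
    and A: "\<And>u. u \<in> {s..t} \<Longrightarrow> cmod (expo (h u)) * \<bar>Re (h u)\<bar> \<le> cmod (h u)"
    and uv: "u \<in> {s..t}" "v \<in> {s..t}" "\<bar>Im (h u)\<bar> + 4 * pi \<le> \<bar>Im (h v)\<bar>"
  shows False
proof -
  have ci: "continuous_on {s..t} (\<lambda>u. Im (h u))" using h by (intro continuous_intros)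
  have n0: "Im (h w) \<noteq> 0" if "w \<in> {s..t}" for w using im(1)[OF that] by auto
  show False
  proof (cases "Im (h u) > 0")
    case True
    have pos: "Im (h w) > 0" if "w \<in> {s..t}" for w
      using attains_between[OF ci that uv(1), of 0] n0 True by force
    show False
    proof (rule no_strip_crossing[OF c h avoid _ _ _ uv(1,2)])
      show "2 \<le> Im (h w)" if "w \<in> {s..t}" for w using im(1)[OF that] pos[OF that] by simp
      show "Im (h u) + 4 * pi \<le> Im (h v)" using uv pos[OF uv(1)] pos[OF uv(2)] by simp
    qed (use im A in auto)
  next
    case False
    have neg: "Im (h w) < 0" if "w \<in> {s..t}" for w
      using attains_between[OF ci uv(1) that, of 0] n0 False by force
    show False
    proof (rule no_strip_crossing[of c s t "\<lambda>w. cnj (h w)", OF c _ _ _ _ _ _ uv(1,2)])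
      show "2 \<le> Im (cnj (h w))" if "w \<in> {s..t}" for w using im(1)[OF that] neg[OF that] by simp
      show "Im (cnj (h u)) + 4 * pi \<le> Im (cnj (h v))" using uv neg[OF uv(1)] neg[OF uv(2)] by simp
      show "continuous_on {s..t} (\<lambda>w. cnj (h w))" using h by (intro continuous_intros)
    qed (use im A avoid in \<open>auto simp: cnj_haven f_lam_cnj expo_cnj\<close>)
  qed
qed

text \<open>
  The window on \<^term>\<open>Im (expo z)\<close> keeps \<^term>\<open>expo\<close> from winding around 0, which bounds the
  variation of \<^term>\<open>Im z\<close>; that of \<^term>\<open>Re z\<close> is bounded by that of the logarithms.
\<close>
lemma no_spiral_crossing:
  assumes c: "c \<ge> 1" and h: "crossing h s t l" "l \<ge> 100"
    and avoid: "\<And>u. u \<in> {s..t} \<Longrightarrow> h u \<notin> haven" "\<And>u. u \<in> {s..t} \<Longrightarrow> f_lam c (h u) \<notin> haven"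
    and pos: "\<And>u. u \<in> {s..t} \<Longrightarrow> ln (cmod (h u)) \<ge> l"
    and a: "a \<ge> 100" "\<And>u. u \<in> {s..t} \<Longrightarrow> a < cmod (expo (h u)) \<and> cmod (expo (h u)) \<le> 10 * a"
  shows False
proof -
  have hc: "continuous_on {s..t} h" using h by (simp add: crossing_def)
  have nz: "h w \<noteq> 0" if "w \<in> {s..t}" for w
    using crossing_nonzero[OF h(1) _ that] h(2) by simp
  have fnz: "f_lam c (h w) \<noteq> 0" if "w \<in> {s..t}" for w
    using nz[OF that] c by (simp add: f_lam_eq_0_iff)
  have nn: "h w \<notin> \<real>\<^sub>\<ge>\<^sub>0" "f_lam c (h w) \<notin> \<real>\<^sub>\<ge>\<^sub>0" if "w \<in> {s..t}" for w
    using not_haven_nonneg that nz fnz avoid by auto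
  then have np: "- h w \<notin> \<real>\<^sub>\<le>\<^sub>0" if "w \<in> {s..t}" for w
    using that by (simp add: complex_nonneg_Reals_iff complex_nonpos_Reals_iff)
  have window: "\<bar>Im (expo (h u)) - Im (expo (h v))\<bar> < 4 * pi" if "u \<in> {s..t}" "v \<in> {s..t}" for u v
    using Im_expo_window[OF _ hc _ _ that, of c] c nn by auto
  \<comment> \<open>A continuous branch of the argument of \<open>- expo (h w)\<close>.\<close>
  define \<alpha> where "\<alpha> = (\<lambda>w. - Im (h w) - Im (Ln (- h w)))"
  have \<alpha>c: "continuous_on {s..t} \<alpha>"
    unfolding \<alpha>_def using np by (intro continuous_intros hc) auto
  have ImA: "Im (expo (h w)) = - cmod (expo (h w)) * sin (\<alpha> w)" if "w \<in> {s..t}" for w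
  proof -
    have "expo (h w) = - exp (- h w - Ln (- h w))"
      using nz[OF that] by (simp add: expo_def exp_diff)
    then show ?thesis by (simp add: \<alpha>_def Im_exp)
  qed
  \<comment> \<open>The sine of \<open>\<alpha>\<close> cannot take both values 1 and -1: the two
    values of \<open>Im (expo (h w))\<close> would differ by more than \<open>2 * a\<close>, hence
    by more than the window allows. If one value is missed, a shift by \<open>pi / 2\<close> makes
    \<open>arg_window\<close> applicable.\<close>
  have \<alpha>: "\<bar>\<alpha> u - \<alpha> v\<bar> < 2 * pi" if uv: "u \<in> {s..t}" "v \<in> {s..t}" for u v
  proof (cases "\<exists>w\<in>{s..t}. sin (\<alpha> w) = 1")
    case False
    have "\<bar>(\<alpha> u + pi/2) - (\<alpha> v + pi/2)\<bar> < 2 * pi"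
      by (rule arg_window[OF _ uv]) (use False in \<open>auto simp: cos_add intro: continuous_intros \<alpha>c\<close>)
    then show ?thesis by simp
  next
    case True
    then obtain w where w: "w \<in> {s..t}" "sin (\<alpha> w) = 1" by blast
    have "sin (\<alpha> w') \<noteq> - 1" if w': "w' \<in> {s..t}" for w'
    proof
      assume "sin (\<alpha> w') = - 1"
      then show False
        using ImA[OF w'] ImA[OF w(1)] w(2) window[OF w' w(1)] a(2)[OF w'] a(2)[OF w(1)] a(1) pi_less_4
        by simp
    qed
    then have "\<bar>(\<alpha> u - pi/2) - (\<alpha> v - pi/2)\<bar> < 2 * pi"
      by (intro arg_window[OF _ uv]) (auto simp: cos_diff intro: continuous_intros \<alpha>c)
    then show ?thesis by simp
  qed
  obtain u v where uv: "u \<in> {s..t}" "v \<in> {s..t}" "lnorm (h u) = l" "lnorm (h v) = l + 10"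
    using h(1) by (auto simp: crossing_def)
  then have lu: "ln (cmod (h u)) = l" "ln (cmod (h v)) = l + 10"
    using pos[OF uv(1)] pos[OF uv(2)] h(2) by linarith+
  have "- pi < Im (Ln (- h w))" "Im (Ln (- h w)) \<le> pi" if "w \<in> {s..t}" for w
    using nz[OF that] by (auto intro: mpi_less_Im_Ln Im_Ln_le_pi)
  from this[OF uv(1)] this[OF uv(2)]
  have "\<bar>Im (Ln (- h u)) - Im (Ln (- h v))\<bar> < 2 * pi" by linarith
  with \<alpha>[OF uv(1,2)] have Im: "\<bar>Im (h u) - Im (h v)\<bar> < 4 * pi"
    unfolding \<alpha>_def by linarith
  have lnA: "ln (cmod (expo (h w))) = - Re (h w) - ln (cmod (h w))" if "w \<in> {s..t}" for w
    using nz[OF that] by (simp add: norm_expo ln_div)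
  have rng: "ln a \<le> ln (cmod (expo (h w)))" "ln (cmod (expo (h w))) \<le> ln a + 9" if "w \<in> {s..t}" for w
  proof -
    show "ln a \<le> ln (cmod (expo (h w)))" using a(2)[OF that] a(1) by (subst ln_le_cancel_iff) auto
    have "ln (cmod (expo (h w))) \<le> ln (10 * a)" using a(2)[OF that] a(1) by (subst ln_le_cancel_iff) auto
    also have "\<dots> = ln 10 + ln a" using a(1) by (intro ln_mult_pos) auto
    also have "ln 10 \<le> (9::real)" using ln_le_minus_one[of "10::real"] by simp
    finally show "ln (cmod (expo (h w))) \<le> ln a + 9" by simp
  qed
  \<comment> \<open>The factor 10 in the modulus of \<open>expo\<close> contributes 9 and the
    crossing contributes 10. Hence the two points are at most 35 apart, although their moduli are
    \<open>exp l\<close> and \<open>exp (l + 10)\<close>.\<close>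
  have "\<bar>Re (h u) - Re (h v)\<bar> \<le> 19"
    using rng[OF uv(1)] rng[OF uv(2)] lnA[OF uv(1)] lnA[OF uv(2)] lu by linarith
  then have "cmod (h v - h u) \<le> 19 + 4 * pi"
    using cmod_le[of "h v - h u"] Im by simp
  then have "cmod (h v) - cmod (h u) \<le> 35"
    using norm_triangle_ineq2[of "h v" "h u"] pi_less_4 by linarith
  moreover have "cmod (h u) = exp l" "cmod (h v) = exp (l + 10)"
    using lu nz[OF uv(1)] nz[OF uv(2)] by (metis exp_ln zero_less_norm_iff)+
  moreover have "exp (10::real) \<ge> 2" using exp_ge_add_one_self[of "10::real"] by linarith
  then have "exp l * exp 10 \<ge> exp l * 2" by (intro mult_left_mono) auto
  moreover have "exp l \<ge> 1 + l" by simp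
  ultimately show False using h(2) by (simp add: exp_add)
qed

section \<open>The general step for crossings\<close>

lemma exp_ge_square:
  assumes "l \<ge> (100::real)"
  shows "exp l \<ge> 100 * l\<^sup>2"
proof -
  have "exp (l/2) \<ge> 1 + l/2 + (l/2)\<^sup>2/2" using assms by (intro exp_lower_Taylor_quadratic) auto
  then have "exp (l/2) \<ge> l\<^sup>2/8" using assms by (simp add: power2_eq_square)
  also have "l\<^sup>2/8 \<ge> 100 * l / 8" using assms by (simp add: power2_eq_square)
  finally have "exp (l/2) \<ge> 10 * l" using assms by simp
  then have "exp (l/2) * exp (l/2) \<ge> (10 * l) * (10 * l)" using assms by (intro mult_mono) auto
  then show ?thesis by (simp add: power2_eq_square flip: exp_add)
qed

text \<open>If \<open>cmod (expo (h w))\<close> stayed below \<open>20 * l\<close>, the formula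
  \<open>norm_expo\<close> would bound \<open>Re (h w)\<close> below by \<open>- 3 * l\<close>; off
  \<open>haven\<close> it is below 1. The curve would be nearly vertical, with a change of
  \<open>\<bar>Im (h w)\<bar>\<close> of order \<open>exp l\<close>, which
  \<open>no_strip_crossing_abs\<close> excludes.\<close>

lemma crossing_expo_large:
  assumes c: "c \<ge> 100" and h: "crossing h s t l" "l \<ge> ln c + 100"
    and avoid: "\<And>u. u \<in> {s..t} \<Longrightarrow> h u \<notin> haven" "\<And>u. u \<in> {s..t} \<Longrightarrow> f_lam c (h u) \<notin> haven"
    and pos: "\<And>u. u \<in> {s..t} \<Longrightarrow> ln (cmod (h u)) \<ge> l"
  shows "\<exists>u\<in>{s..t}. cmod (expo (h u)) \<ge> 10 * (l + 10 + ln c)"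
proof (rule ccontr)
  assume "\<not> ?thesis"
  moreover have L: "ln c \<ge> 0" using c by simp
  ultimately have A: "cmod (expo (h w)) < 20 * l" if "w \<in> {s..t}" for w
    using that h(2) by force
  have l: "l \<ge> 100" using h(2) L by simp
  have hc: "continuous_on {s..t} h" using h by (simp add: crossing_def)
  have nz: "h w \<noteq> 0" if "w \<in> {s..t}" for w
    using crossing_nonzero[OF h(1) _ that] l by simp
  have lw: "ln (cmod (h w)) \<le> l + 10" if "w \<in> {s..t}" for w
    using h(1) that by (auto simp: crossing_def abs_le_iff)
  have z: "cmod (h w) \<ge> exp l" if "w \<in> {s..t}" for w
    using pos[OF that] nz[OF that] by (simp add: ln_ge_iff)
  have sq: "exp l \<ge> 100 * l\<^sup>2" "l\<^sup>2 \<ge> 100 * l"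
    using exp_ge_square[OF l] l by (auto simp: power2_eq_square)
  have Re: "\<bar>Re (h w)\<bar> \<le> 3 * l" if w: "w \<in> {s..t}" for w
  proof -
    have "Re (h w) < 1" using avoid(1)[OF w] by (auto simp: haven_def)
    have "expo (h w) \<noteq> 0" using nz[OF w] by (simp add: expo_def)
    then have "ln (cmod (expo (h w))) \<le> ln (20 * l)"
      using A[OF w] l by (subst ln_le_cancel_iff) auto
    also have "\<dots> = ln 20 + ln l" using l by (intro ln_mult_pos) auto
    also have "\<dots> \<le> 19 + (l - 1)" 
      using ln_le_minus_one[of "20::real"] ln_le_minus_one[of l] l by simp
    finally have "ln (cmod (expo (h w))) \<le> l + 18" by simp
    moreover have "ln (cmod (expo (h w))) = - Re (h w) - ln (cmod (h w))"
      using nz[OF w] by (simp add: norm_expo ln_div)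
    ultimately show ?thesis using lw[OF w] l \<open>Re (h w) < 1\<close> by linarith
  qed
  have Im: "\<bar>Im (h w)\<bar> \<ge> cmod (h w) - 3 * l" if w: "w \<in> {s..t}" for w
    using cmod_le[of "h w"] Re[OF w] by linarith
  have Im10: "\<bar>Im (h w)\<bar> \<ge> 10 * l" if w: "w \<in> {s..t}" for w
    using Im[OF w] z[OF w] sq l by linarith
  obtain u v where uv: "u \<in> {s..t}" "v \<in> {s..t}" "lnorm (h u) = l" "lnorm (h v) = l + 10"
    using h(1) by (auto simp: crossing_def)
  then have lu: "ln (cmod (h u)) = l" "ln (cmod (h v)) = l + 10"
    using pos[OF uv(1)] pos[OF uv(2)] l by linarith+
  have euv: "cmod (h u) = exp l" "cmod (h v) = exp (l + 10)"
    using lu nz[OF uv(1)] nz[OF uv(2)] by (metis exp_ln zero_less_norm_iff)+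
  have "exp (10::real) \<ge> 2" using exp_ge_add_one_self[of "10::real"] by linarith
  then have "exp l * exp 10 \<ge> exp l * 2" by (intro mult_left_mono) auto
  then have "cmod (h v) \<ge> 2 * exp l" using euv by (simp add: exp_add)
  moreover have "\<bar>Im (h u)\<bar> \<le> exp l" using abs_Im_le_cmod[of "h u"] euv by simp
  ultimately have "\<bar>Im (h u)\<bar> + 4 * pi \<le> \<bar>Im (h v)\<bar>"
    using Im[OF uv(2)] sq l pi_less_4 by linarith
  then show False
  proof (rule no_strip_crossing_abs[OF c hc avoid _ _ _ uv(1,2), rotated -1])
    fix w assume w: "w \<in> {s..t}"
    show "2 \<le> \<bar>Im (h w)\<bar>" using Im10[OF w] l by linarith
    have "\<bar>Im (h w)\<bar>\<^sup>2 \<ge> (10 * l)\<^sup>2" using Im10[OF w] l by (intro power_mono) auto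
    then have "(Im (h w))\<^sup>2 \<ge> 100 * l\<^sup>2" by (simp add: power_mult_distrib)
    then show "2 * \<bar>Re (h w)\<bar> + 1 \<le> (Im (h w))\<^sup>2" using Re[OF w] sq l by linarith
    have "cmod (expo (h w)) * \<bar>Re (h w)\<bar> \<le> (20 * l) * (3 * l)"
      using A[OF w] Re[OF w] l by (intro mult_mono) auto
    also have "\<dots> = 60 * l\<^sup>2" by (simp add: power2_eq_square)
    also have "\<dots> \<le> cmod (h w)" using z[OF w] sq l by linarith
    finally show "cmod (expo (h w)) * \<bar>Re (h w)\<bar> \<le> cmod (h w)" .
  qed
qed

text \<open>Close to infinity let \<open>10 * a\<close> be the maximum of
  \<open>cmod (expo (h u))\<close>, which is large by \<open>crossing_expo_large\<close>. By
  \<open>no_spiral_crossing\<close> the modulus also drops to \<open>a\<close> or below, and these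
  two points feed \<open>crossing_expo_ratio\<close>.\<close>

lemma crossing_step:
  assumes c: "c \<ge> 100" and h: "crossing h s t l" "l \<ge> ln c + 100"
    and avoid: "\<And>u. u \<in> {s..t} \<Longrightarrow> h u \<notin> haven" "\<And>u. u \<in> {s..t} \<Longrightarrow> f_lam c (h u) \<notin> haven"
  shows "\<exists>s' t' l'. s \<le> s' \<and> t' \<le> t \<and> l + 1 \<le> l' \<and> crossing (\<lambda>u. f_lam c (h u)) s' t' l'"
proof -
  have L: "ln c \<ge> 0" using c by simp
  consider "\<And>u. u \<in> {s..t} \<Longrightarrow> ln (cmod (h u)) \<le> - l" | "\<And>u. u \<in> {s..t} \<Longrightarrow> ln (cmod (h u)) \<ge> l"
    using crossing_sign[OF h(1)] h(2) L by fastforce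
  then show ?thesis
  proof cases
    case 1
    then show ?thesis using crossing_step_near_0[OF _ h avoid 1] c by simp
  next
    case 2
    have hc: "continuous_on {s..t} h" and st: "s \<le> t" using h by (simp_all add: crossing_def)
    have nz: "h w \<noteq> 0" if "w \<in> {s..t}" for w
      using crossing_nonzero[OF h(1) _ that] h(2) L by simp
    have "continuous_on {s..t} (\<lambda>w. cmod (expo (h w)))"
      by (intro continuous_on_norm continuous_on_expo hc nz)
    from continuous_attains_sup[OF compact_Icc _ this]
    obtain v where v: "v \<in> {s..t}" "\<And>w. w \<in> {s..t} \<Longrightarrow> cmod (expo (h w)) \<le> cmod (expo (h v))"
      using st by auto
    define a where "a = cmod (expo (h v)) / 10"
    have a: "a \<ge> l + 10 + ln c"
      using crossing_expo_large[OF c h avoid 2] v by (force simp: a_def)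
    have "\<exists>u\<in>{s..t}. cmod (expo (h u)) \<le> a"
    proof (rule ccontr)
      assume neg: "\<not> ?thesis"
      show False
      proof (rule no_spiral_crossing[OF _ h(1) _ avoid 2])
        show "100 \<le> a" "1 \<le> c" "100 \<le> l" using c h(2) L a by linarith+
        show "a < cmod (expo (h w)) \<and> cmod (expo (h w)) \<le> 10 * a" if "w \<in> {s..t}" for w
          using neg v(2)[OF that] that by (force simp: a_def)
      qed
    qed
    then obtain u where u: "u \<in> {s..t}" "cmod (expo (h u)) \<le> a" by blast
    have "\<exists>s' t'. s \<le> s' \<and> t' \<le> t \<and> crossing (\<lambda>u. f_lam c (h u)) s' t' (2 * a)"
      using crossing_expo_ratio[OF _ h(1) _ avoid u(1) v(1) a u(2)] c h(2) L by (simp add: a_def)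
    moreover have "l + 1 \<le> 2 * a" using a h(2) L by linarith
    ultimately show ?thesis by blast
  qed
qed

section \<open>A closed subset of the escaping set\<close>

text \<open>Each alternative is a relatively closed condition on \<open>z\<close> in the punctured
  plane. The second one persists once it holds, since \<open>haven\<close> is mapped into
  itself.\<close>

definition tame_escape :: "real \<Rightarrow> complex set" where
  "tame_escape c = {z. z \<noteq> 0 \<and> (\<forall>n. real n \<le> lnorm ((f_lam c ^^ n) z) \<or> (f_lam c ^^ n) z \<in> haven)}"

lemma iterate_f_lam_nonzero: "c > 0 \<Longrightarrow> z \<noteq> 0 \<Longrightarrow> (f_lam c ^^ n) z \<noteq> 0"
  by (induction n) (auto simp: f_lam_eq_0_iff)

lemma crossing_meets_tame_escape:
  assumes c: "c \<ge> 100" and h: "crossing h s t l" "l \<ge> ln c + 100"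
  shows "\<exists>u\<in>{s..t}. h u \<in> tame_escape c"
proof (rule ccontr)
  assume miss: "\<not> ?thesis"
  have L: "ln c \<ge> 0" using c by simp
  have nz: "h u \<noteq> 0" if "u \<in> {s..t}" for u
    using crossing_nonzero[OF h(1) _ that] h(2) L by simp
  define F where "F = (\<lambda>n u. (f_lam c ^^ n) (h u))"
  \<comment> \<open>Stage \<open>n\<close> records a subinterval on which the \<open>n\<close>-th
    image is a crossing, and its level \<open>k\<close>. The level gains at least 1 with each
    iterate, which gives the linear rate.\<close>
  define P where "P = (\<lambda>n (a, b, k). s \<le> a \<and> b \<le> t \<and> ln c + 100 + real n \<le> k \<and> crossing (F n) a b k \<and>
      (\<forall>j\<le>n. \<forall>u\<in>{a..b}. real j \<le> lnorm (F j u)))"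
  define Q where "Q = (\<lambda>(n::nat) (a, b, k::real) (a', b', k'::real). a \<le> a' \<and> b' \<le> (b::real) \<and> a \<le> (a'::real))"
  \<comment> \<open>An orbit that grows linearly up to time \<open>m\<close> and is then in
    \<open>haven\<close> belongs to \<open>tame_escape c\<close>. As the curve misses that set, its
    images avoid \<open>haven\<close>, as \<open>crossing_step\<close> requires.\<close>
  have avoid: "F m u \<notin> haven" if "\<forall>j<m. real j \<le> lnorm (F j u)" "u \<in> {s..t}" for m u
  proof
    assume hv: "F m u \<in> haven"
    have "real n \<le> lnorm (F n u) \<or> F n u \<in> haven" for n
    proof (cases "n < m")
      case False
      then have "F n u = (f_lam c ^^ (n - m)) (F m u)"
        using funpow_add[of "n - m" m "f_lam c"] by (simp add: F_def)
      then show ?thesis using iterate_f_lam_haven(1)[OF _ hv] c by simp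
    qed (use that in auto)
    then have "h u \<in> tame_escape c"
      using nz[OF that(2)] by (auto simp: tame_escape_def F_def)
    with miss that(2) show False by blast
  qed
  have "\<exists>x. P 0 x"
  proof
    have "F 0 = h" by (simp add: F_def fun_eq_iff)
    then show "P 0 (s, t, l)"
      using h by (auto simp: P_def)
  qed
  moreover have "\<exists>y. P (Suc n) y \<and> Q n x y" if Px: "P n x" for x n
  proof -
    obtain a b k where x: "x = (a, b, k)" by (cases x)
    have 1: "s \<le> a" "b \<le> t" "ln c + 100 + real n \<le> k" "crossing (F n) a b k"
      "\<And>j u. j \<le> n \<Longrightarrow> u \<in> {a..b} \<Longrightarrow> real j \<le> lnorm (F j u)"
      using Px by (auto simp: P_def x)
    have FS: "F (Suc n) = (\<lambda>u. f_lam c (F n u))" by (simp add: F_def fun_eq_iff)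
    have "\<exists>s' t' l'. a \<le> s' \<and> t' \<le> b \<and> k + 1 \<le> l' \<and> crossing (\<lambda>u. f_lam c (F n u)) s' t' l'"
    proof (rule crossing_step[OF c 1(4)])
      show "k \<ge> ln c + 100" using 1(3) by simp
      show "F n u \<notin> haven" if "u \<in> {a..b}" for u
        using avoid[of n u] that 1 by auto
      show "f_lam c (F n u) \<notin> haven" if "u \<in> {a..b}" for u
        using avoid[of "Suc n" u] that 1 by (auto simp: FS)
    qed
    then obtain a' b' k' where 2: "a \<le> a'" "b' \<le> b" "k + 1 \<le> k'" "crossing (F (Suc n)) a' b' k'"
      unfolding FS by blast
    have "real j \<le> lnorm (F j u)" if "j \<le> Suc n" "u \<in> {a'..b'}" for j u
    proof (cases "j \<le> n")
      case True
      then show ?thesis using 1(5)[of j u] that 2 by auto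
    next
      case False
      then have "j = Suc n" using that by simp
      moreover have "k' \<le> lnorm (F (Suc n) u)" using 2(4) that(2) by (auto simp: crossing_def)
      ultimately show ?thesis using 1(3) 2(3) L by simp
    qed
    then have "P (Suc n) (a', b', k') \<and> Q n x (a', b', k')"
      using 1 2 by (auto simp: P_def Q_def x)
    then show ?thesis by blast
  qed
  ultimately obtain X where X: "\<And>n. P n (X n)" "\<And>n. Q n (X n) (X (Suc n))"
    using dependent_nat_choice[of P Q] by metis
  define I where "I = (\<lambda>n. {fst (X n)..fst (snd (X n))})"
  have "(\<Inter>n. I n) \<noteq> {}"
  proof (rule compact_nest)
    show "compact (I n)" for n by (simp add: I_def)
    show "I n \<noteq> {}" for n
      using X(1)[of n] by (cases "X n") (auto simp: P_def I_def crossing_def)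
    have "I (Suc n) \<subseteq> I n" for n
      using X(2)[of n] by (cases "X n"; cases "X (Suc n)") (auto simp: Q_def I_def)
    then show "I n \<subseteq> I m" if "m \<le> n" for m n
      using that by (rule lift_Suc_antimono_le)
  qed
  then obtain u where u: "\<And>n. u \<in> I n" by blast
  have "u \<in> {s..t}" using u[of 0] X(1)[of 0] by (cases "X 0") (auto simp: P_def I_def)
  moreover have "real n \<le> lnorm (F n u)" for n
    using u[of n] X(1)[of n] by (cases "X n") (auto simp: P_def I_def)
  then have "h u \<in> tame_escape c"
    using nz[OF \<open>u \<in> {s..t}\<close>] by (simp add: tame_escape_def F_def)
  ultimately show False using miss by blast
qed

text \<open>The sign \<open>\<sigma>\<close> selects the end: 1 for infinity, -1 for 0. Between the
  two levels \<open>\<sigma> * ln (cmod z)\<close> is positive and so equals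
  \<open>lnorm z\<close>.\<close>

lemma path_meets_tame_escape:
  assumes c: "c \<ge> 100" and l: "l \<ge> ln c + 100" and g: "path g" "0 \<notin> path_image g"
    and \<sigma>: "\<sigma> = 1 \<or> \<sigma> = (-1 :: real)"
    and pq: "p \<in> path_image g" "q \<in> path_image g" "\<sigma> * ln (cmod p) \<le> l" "l + 10 \<le> \<sigma> * ln (cmod q)"
  shows "\<exists>z\<in>path_image g \<inter> tame_escape c. l \<le> \<sigma> * ln (cmod z) \<and> \<sigma> * ln (cmod z) \<le> l + 10"
proof -
  have L: "ln c \<ge> 0" using c by simp
  obtain u v where uv: "u \<in> {0..1}" "g u = p" "v \<in> {0..1}" "g v = q"
    using pq unfolding path_image_def by blast
  have nz: "g w \<noteq> 0" if "w \<in> {0..1}" for w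
    using g(2) that unfolding path_image_def by force
  have gc: "continuous_on {0..1} g" using g(1) by (simp add: path_def)
  have "continuous_on {0..1} (\<lambda>w. \<sigma> * ln (cmod (g w)))"
    using nz by (intro continuous_intros gc) auto
  from subinterval_between[OF this uv(1,3), of l "l + 10"] uv pq
  obtain s t where st: "0 \<le> s" "s \<le> t" "t \<le> 1"
      "(\<lambda>w. \<sigma> * ln (cmod (g w))) ` {s..t} \<subseteq> {l..l + 10}"
      "\<exists>w\<in>{s..t}. \<sigma> * ln (cmod (g w)) = l" "\<exists>w\<in>{s..t}. \<sigma> * ln (cmod (g w)) = l + 10"
    by auto
  have range: "l \<le> \<sigma> * ln (cmod (g w))" "\<sigma> * ln (cmod (g w)) \<le> l + 10" if "w \<in> {s..t}" for w
    using st(4) that by (auto simp: image_subset_iff)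
  then have eq: "lnorm (g w) = \<sigma> * ln (cmod (g w))" if "w \<in> {s..t}" for w
    using range(1)[OF that] \<sigma> l L by auto
  have "continuous_on {s..t} g" using gc by (rule continuous_on_subset) (use st in auto)
  then have "crossing g s t l"
    unfolding crossing_def using st range eq by auto
  from crossing_meets_tame_escape[OF c this l]
  obtain w where w: "w \<in> {s..t}" "g w \<in> tame_escape c" by blast
  moreover have "g w \<in> path_image g" using w st by (auto simp: path_image_def)
  ultimately show ?thesis using range by blast
qed

section \<open>Relative closedness of the tame set\<close>

lemma continuous_on_iterate_f_lam:
  assumes "c > 0"
  shows "continuous_on (- {0}) (f_lam c ^^ n)"
proof (induction n)
  case (Suc n)
  have "continuous_on (- {0}) (\<lambda>z. f_lam c ((f_lam c ^^ n) z))"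
    using Suc assms by (intro continuous_on_f_lam) (auto simp: iterate_f_lam_nonzero)
  then show ?case by (simp add: comp_def)
qed (simp add: continuous_on_id id_def)

text \<open>The half-line accumulates at 0. Adding this point changes no preimage in the punctured
  plane, because the iterates do not vanish there.\<close>

lemma closed_haven_Un_0: "closed (insert 0 haven)"
proof -
  have "insert 0 haven = {z. 1 \<le> Re z} \<union> ({z. Im z = 0} \<inter> {z. 0 \<le> Re z})"
    by (auto simp: haven_def complex_eq_iff)
  then show ?thesis
    by (auto intro!: closed_Un closed_Int closed_halfspace_Re_ge closed_Collect_eq continuous_intros)
qed

lemma closedin_tame_escape:
  assumes "c > 0"
  shows "closedin (top_of_set (- {0})) (tame_escape c)"
proof -
  have "closedin (top_of_set (- {0})) {z \<in> - {0}. real n \<le> lnorm ((f_lam c ^^ n) z) \<or> (f_lam c ^^ n) z \<in> haven}" for n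
  proof -
    let ?F = "f_lam c ^^ n"
    have F: "continuous_on (- {0}) ?F" by (rule continuous_on_iterate_f_lam[OF assms])
    have nz: "?F z \<noteq> 0" if "z \<in> - {0}" for z using iterate_f_lam_nonzero[OF assms] that by auto
    have "closedin (top_of_set (- {0})) (- {0} \<inter> (\<lambda>z. lnorm (?F z)) -` {real n..})"
      by (intro continuous_closedin_preimage continuous_on_lnorm F nz) auto
    moreover have "closedin (top_of_set (- {0})) (- {0} \<inter> ?F -` insert 0 haven)"
      by (intro continuous_closedin_preimage F closed_haven_Un_0)
    ultimately have "closedin (top_of_set (- {0}))
       ((- {0} \<inter> (\<lambda>z. lnorm (?F z)) -` {real n..}) \<union> (- {0} \<inter> ?F -` insert 0 haven))"
      by (rule closedin_Un)
    moreover have "(- {0} \<inter> (\<lambda>z. lnorm (?F z)) -` {real n..}) \<union> (- {0} \<inter> ?F -` insert 0 haven) =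
       {z \<in> - {0}. real n \<le> lnorm (?F z) \<or> ?F z \<in> haven}"
      using nz by auto
    ultimately show ?thesis by simp
  qed
  then have "closedin (top_of_set (- {0})) (\<Inter>n. {z \<in> - {0}. real n \<le> lnorm ((f_lam c ^^ n) z) \<or> (f_lam c ^^ n) z \<in> haven})"
    by (intro closedin_INT) auto
  moreover have "(\<Inter>n. {z \<in> - {0}. real n \<le> lnorm ((f_lam c ^^ n) z) \<or> (f_lam c ^^ n) z \<in> haven}) = tame_escape c"
    by (auto simp: tame_escape_def)
  ultimately show ?thesis by simp
qed

definition log_annulus :: "real \<Rightarrow> real \<Rightarrow> complex set" where
  "log_annulus a b = {z. z \<noteq> 0 \<and> a \<le> ln (cmod z) \<and> ln (cmod z) \<le> b}"

lemma log_annulus_altdef: "log_annulus a b = cball 0 (exp b) - ball 0 (exp a)"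
proof -
  have "a \<le> ln (cmod z) \<longleftrightarrow> exp a \<le> cmod z" "ln (cmod z) \<le> b \<longleftrightarrow> cmod z \<le> exp b" if "z \<noteq> 0" for z
    using that by (simp_all add: ln_ge_iff) (metis exp_le_cancel_iff exp_ln zero_less_norm_iff)
  moreover have "z \<noteq> 0" if "exp a \<le> cmod z" for z
    using that exp_gt_zero[of a] by (auto simp del: exp_gt_zero)
  ultimately show ?thesis unfolding log_annulus_def by (auto simp: not_less)
qed

lemma compact_log_annulus: "compact (log_annulus a b)"
  unfolding log_annulus_altdef by (intro compact_diff) auto

lemma lnorm_le_iff: "z \<noteq> 0 \<Longrightarrow> lnorm z \<le> b \<longleftrightarrow> z \<in> log_annulus (- b) b"
  by (auto simp: log_annulus_def abs_le_iff)

lemma compact_tame_escape_annulus: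
  assumes "c > 0"
  shows "compact (tame_escape c \<inter> log_annulus a b)"
proof -
  obtain C where "closed C" "tame_escape c = - {0} \<inter> C"
    using closedin_tame_escape[OF assms] by (auto simp: closedin_closed)
  moreover from this have "tame_escape c \<inter> log_annulus a b = log_annulus a b \<inter> C"
    by (auto simp: log_annulus_def)
  ultimately show ?thesis
    by (simp add: compact_Int_closed compact_log_annulus)
qed

section \<open>The escaping set in terms of logarithms of moduli\<close>

lemma open_Some_image: "open S \<Longrightarrow> openin riemann_sphere (Some ` S)"
  by (simp add: riemann_sphere_def)

lemma topspace_riemann_sphere: "topspace riemann_sphere = UNIV"
  unfolding riemann_sphere_def by (auto simp: UNIV_option_conv)

text \<open>Infinitely many visits to a compact annulus produce a limit point in it; conversely a
  finite nonzero limit point has a neighbourhood where \<open>lnorm\<close> is bounded. The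
  alternative 0 is present because the orbit under an arbitrary \<open>f\<close> may hit 0, where
  \<open>lnorm\<close> carries no information.\<close>

lemma escaping_set_iff:
  "z \<in> escaping_set f \<longleftrightarrow> z \<noteq> 0 \<and>
     (\<forall>b. \<forall>\<^sub>F n in sequentially. (f ^^ n) z = 0 \<or> b < lnorm ((f ^^ n) z))"
  (is "?L \<longleftrightarrow> z \<noteq> 0 \<and> ?R")
proof (cases "z = 0")
  case False
  have "?R" if L: ?L
  proof (rule ccontr)
    assume "\<not> ?R"
    then obtain b where "\<exists>\<^sub>F n in sequentially. (f ^^ n) z \<noteq> 0 \<and> lnorm ((f ^^ n) z) \<le> b"
      by (auto simp: not_eventually not_less)
    then have fr: "\<And>m. \<exists>n\<ge>m. (f ^^ n) z \<in> log_annulus (- b) b"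
      unfolding frequently_sequentially using lnorm_le_iff by metis
    define K where "K = (\<lambda>m. log_annulus (- b) b \<inter> closure {(f ^^ k) z | k. k \<ge> m})"
    have "(\<Inter>m. K m) \<noteq> {}"
    proof (rule compact_nest)
      show "compact (K n)" for n
        unfolding K_def by (intro compact_Int_closed compact_log_annulus) auto
      show "K n \<noteq> {}" for n
      proof -
        obtain k where k: "k \<ge> n" "(f ^^ k) z \<in> log_annulus (- b) b" using fr by blast
        then have "(f ^^ k) z \<in> closure {(f ^^ k) z | k. k \<ge> n}"
          by (intro closure_subset[THEN subsetD]) auto
        with k show ?thesis by (auto simp: K_def)
      qed
      show "K n \<subseteq> K m" if "m \<le> n" for m n
        unfolding K_def using that by (intro Int_mono closure_mono) auto
    qed
    then obtain p where p: "\<And>m. p \<in> K m" by blast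
    have "Some p \<in> riemann_sphere closure_of {Some ((f ^^ k) z) | k. k \<ge> m}" for m
    proof -
      have "p \<in> euclidean closure_of {(f ^^ k) z | k. k \<ge> m}" using p by (auto simp: K_def)
      moreover have "Some ` (euclidean closure_of {(f ^^ k) z | k. k \<ge> m}) \<subseteq>
          riemann_sphere closure_of (Some ` {(f ^^ k) z | k. k \<ge> m})"
        unfolding riemann_sphere_def
        by (rule continuous_map_image_closure_subset[OF continuous_map_Some])
      moreover have "Some ` {(f ^^ k) z | k. k \<ge> m} = {Some ((f ^^ k) z) | k. k \<ge> m}"
        by auto
      ultimately show ?thesis by auto
    qed
    then have "Some p \<in> omega_limit z f" by (auto simp: omega_limit_def)
    then have "Some p \<in> {Some 0, None}" using L by (auto simp: escaping_set_def)
    then show False using p[of 0] by (auto simp: K_def log_annulus_def)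
  qed
  moreover have ?L if R: ?R
  proof -
    have "p = 0" if p: "Some p \<in> omega_limit z f" for p
    proof (rule ccontr)
      assume p0: "p \<noteq> 0"
      define b where "b = lnorm p + 1"
      define U where "U = - {0} \<inter> (\<lambda>w. lnorm w) -` {..<b}"
      have "open U"
        unfolding U_def by (intro continuous_open_preimage continuous_on_lnorm) (auto intro: continuous_intros)
      obtain m where m: "\<And>n. n \<ge> m \<Longrightarrow> (f ^^ n) z = 0 \<or> b < lnorm ((f ^^ n) z)"
        using R by (auto simp: eventually_sequentially)
      have "Some p \<in> riemann_sphere closure_of {Some ((f ^^ k) z) | k. k \<ge> m}"
        using p by (auto simp: omega_limit_def)
      moreover have "Some p \<in> Some ` U" using p0 by (auto simp: U_def b_def)
      ultimately obtain q where "q \<in> {Some ((f ^^ k) z) | k. k \<ge> m}" "q \<in> Some ` U"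
        using open_Some_image[OF \<open>open U\<close>] unfolding in_closure_of by blast
      then show False using m by (force simp: U_def)
    qed
    then show ?L using False by (auto simp: escaping_set_def) (metis not_None_eq)
  qed
  ultimately show ?thesis using False by blast
qed (simp add: escaping_set_def)

lemma f_lam_escaping_iff:
  assumes "c > 0"
  shows "z \<in> escaping_set (f_lam c) \<longleftrightarrow> z \<noteq> 0 \<and> (\<forall>b. \<forall>\<^sub>F n in sequentially. b < lnorm ((f_lam c ^^ n) z))"
  using iterate_f_lam_nonzero[OF assms, of z] by (cases "z = 0") (simp_all add: escaping_set_iff)

lemma haven_escaping:
  assumes "c \<ge> 8" "z \<in> haven"
  shows "z \<in> escaping_set (f_lam c)"
proof -
  have "\<forall>\<^sub>F n in sequentially. b < lnorm ((f_lam c ^^ n) z)" for b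
  proof -
    obtain N where N: "exp b < 2 ^ N"
      using real_arch_pow[of 2 "exp b"] by auto
    have "\<forall>\<^sub>F n in sequentially. exp b < 2 ^ n"
    proof (rule eventually_sequentiallyI[of N])
      fix n assume "N \<le> n"
      then have "(2::real) ^ N \<le> 2 ^ n" by (intro power_increasing) auto
      with N show "exp b < 2 ^ n" by linarith
    qed
    moreover have "\<forall>\<^sub>F n in sequentially. n > 0" by (rule eventually_gt_at_top)
    ultimately show ?thesis
    proof eventually_elim
      case (elim n)
      then obtain m where "n = Suc m" by (cases n) auto
      then have "2 ^ n \<le> cmod ((f_lam c ^^ n) z)"
        using iterate_f_lam_haven(2)[OF assms, of m] complex_Re_le_cmod order_trans by blast
      then have "exp b < cmod ((f_lam c ^^ n) z)" using elim by linarith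
      moreover from this have "0 < cmod ((f_lam c ^^ n) z)"
        using exp_gt_zero[of b] by linarith
      ultimately have "exp b < exp (ln (cmod ((f_lam c ^^ n) z)))" by simp
      then have "b < ln (cmod ((f_lam c ^^ n) z))" by (simp only: exp_less_cancel_iff)
      then show ?case by linarith
    qed
  qed
  then show ?thesis using assms by (auto simp: f_lam_escaping_iff haven_def)
qed

lemma escaping_set_preimage:
  assumes "c > 0" "z \<noteq> 0" "(f_lam c ^^ m) z \<in> escaping_set (f_lam c)"
  shows "z \<in> escaping_set (f_lam c)"
proof -
  have "\<forall>\<^sub>F n in sequentially. b < lnorm ((f_lam c ^^ n) z)" for b
  proof -
    have "\<forall>\<^sub>F n in sequentially. b < lnorm ((f_lam c ^^ n) ((f_lam c ^^ m) z))"
      using assms by (auto simp: f_lam_escaping_iff)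
    then have "\<forall>\<^sub>F n in sequentially. b < lnorm ((f_lam c ^^ (n + m)) z)"
      by (simp add: funpow_add)
    then show ?thesis by (rule eventually_sequentially_seg[THEN iffD1])
  qed
  then show ?thesis using assms by (auto simp: f_lam_escaping_iff)
qed

lemma tame_escape_subset:
  assumes "c \<ge> 8"
  shows "tame_escape c \<subseteq> escaping_set (f_lam c)"
proof
  fix z assume z: "z \<in> tame_escape c"
  show "z \<in> escaping_set (f_lam c)"
  proof (cases "\<exists>n. (f_lam c ^^ n) z \<in> haven")
    case True
    then obtain n where "(f_lam c ^^ n) z \<in> haven" by blast
    then have "(f_lam c ^^ n) z \<in> escaping_set (f_lam c)" by (rule haven_escaping[OF assms])
    moreover have "z \<noteq> 0" "c > 0" using z assms by (auto simp: tame_escape_def)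
    ultimately show ?thesis using escaping_set_preimage by blast
  next
    case False
    have "\<forall>\<^sub>F n in sequentially. b < lnorm ((f_lam c ^^ n) z)" for b
    proof -
      obtain N where "b < real N" using reals_Archimedean2 by blast
      then have "\<forall>\<^sub>F n in sequentially. b < real n"
        by (intro eventually_sequentiallyI[of N]) auto
      then show ?thesis
      proof eventually_elim
        case (elim n)
        moreover have "real n \<le> lnorm ((f_lam c ^^ n) z)"
          using z False by (auto simp: tame_escape_def)
        ultimately show ?case by linarith
      qed
    qed
    moreover have "z \<noteq> 0" "c > 0" using z assms by (auto simp: tame_escape_def)
    ultimately show ?thesis by (simp add: f_lam_escaping_iff)
  qed
qed

section \<open>Domains separating zero from infinity\<close>

lemma frontier_closure_subset: "frontier (closure S) \<subseteq> frontier S"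
  using interior_mono[OF closure_subset[of S]] by (auto simp: frontier_def)

text \<open>Let \<open>V\<close> be the component of \<open>- E\<close> containing \<open>Y\<close>,
  and \<open>G\<close> the component of \<open>- closure V\<close> containing \<open>X\<close>.
  Passing to these components keeps the frontier inside \<open>E\<close>, and \<open>- G\<close> is
  connected because \<open>closure V\<close> is.\<close>

lemma separating_domain:
  fixes E X Y :: "complex set"
  assumes "closed E" and X: "open X" "connected X" "X \<noteq> {}" "X \<inter> E = {}"
    and Y: "connected Y" "Y \<noteq> {}" "Y \<inter> E = {}"
    and sep: "\<And>V. open V \<Longrightarrow> connected V \<Longrightarrow> V \<inter> X \<noteq> {} \<Longrightarrow> V \<inter> Y \<noteq> {} \<Longrightarrow> V \<inter> E \<noteq> {}"
  obtains G where "open G" "connected G" "connected (- G)" "X \<subseteq> G" "Y \<inter> G = {}" "frontier G \<subseteq> E"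
proof -
  obtain V where V: "V \<in> components (- E)" "Y \<subseteq> V"
    using exists_component_superset[of Y "- E"] Y by blast
  have V': "open V" "connected V" "V \<inter> E = {}"
    using open_components[OF _ V(1)] \<open>closed E\<close> in_components_connected[OF V(1)] in_components_subset[OF V(1)]
    by auto
  have "V \<inter> X = {}" using sep[OF V'(1,2)] V'(3) V(2) Y(2) by blast
  then have XV: "X \<inter> closure V = {}"
    using X(1) by (metis inf_commute open_Int_closure_eq_empty)
  obtain G where G: "G \<in> components (- closure V)" "X \<subseteq> G"
    using exists_component_superset[of X "- closure V"] X XV by blast
  have "frontier G \<subseteq> frontier (- closure V)" by (rule frontier_of_components_subset[OF G(1)])
  also have "\<dots> \<subseteq> frontier V" using frontier_closure_subset[of V] by simp
  also have "\<dots> \<subseteq> E" by (rule frontier_of_components_closed_complement[OF \<open>closed E\<close> V(1)])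
  finally have fr: "frontier G \<subseteq> E" .
  show thesis
  proof (rule that[OF _ _ _ G(2) _ fr])
    show "open G" by (rule open_components[OF _ G(1)]) (simp add: open_Compl)
    show "connected G" using G(1) by (rule in_components_connected)
    show "connected (- G)"
      by (rule component_complement_connected[OF connected_imp_connected_closure[OF V'(2)] G(1)])
    show "Y \<inter> G = {}" using V(2) closure_subset[of V] in_components_subset[OF G(1)] by blast
  qed
qed

section \<open>Components of the complement in the sphere\<close>

lemma connected_components_of_two_closed:
  assumes "topspace X = A \<union> B" "A \<inter> B = {}" "A \<noteq> {}" "B \<noteq> {}"
    and A: "closedin X A" "connectedin X A" and B: "closedin X B" "connectedin X B"
  shows "connected_components_of X = {A, B}"
proof -
  \<comment> \<open>Each set is the complement of the other, so both are clopen; a component then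
    lies in one of them and equals it by maximality.\<close>
  have op: "openin X A" "openin X B"
    using assms by (auto simp: openin_closedin_eq) (metis Diff_cancel Un_Diff Un_empty_left Un_empty_right Diff_triv inf_commute)+
  have sub: "C = A \<or> C = B" if C: "C \<in> connected_components_of X" for C
  proof -
    have conn: "connectedin X C" using C by (rule connectedin_connected_components_of)
    have ne: "C \<noteq> {}" "C \<subseteq> A \<union> B"
      using C nonempty_connected_components_of connected_components_of_subset assms(1) by blast+
    have "C \<subseteq> A \<or> disjnt C A"
      using connectedin_clopen_cases[OF conn A(1) op(1)] .
    then show ?thesis
    proof
      assume "C \<subseteq> A"
      moreover from this have "\<not> disjnt C A" using ne by (auto simp: disjnt_def)
      then have "A \<subseteq> C" by (rule connected_components_of_maximal[OF C A(2)])
      ultimately show ?thesis by blast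
    next
      assume "disjnt C A"
      then have "C \<subseteq> B" using ne by (auto simp: disjnt_def)
      moreover from this have "\<not> disjnt C B" using ne by (auto simp: disjnt_def)
      then have "B \<subseteq> C" by (rule connected_components_of_maximal[OF C B(2)])
      ultimately show ?thesis by blast
    qed
  qed
  have "\<Union>(connected_components_of X) = A \<union> B"
    using assms(1) by (simp add: Union_connected_components_of)
  then have "A \<in> connected_components_of X" "B \<in> connected_components_of X"
    using sub assms(2,3,4) by blast+
  with sub show ?thesis by blast
qed

lemma doubly_connected_separatingI:
  assumes H: "compact H" "connected H" "0 \<in> H"
    and K: "closed K" "connected K" "\<not> bounded K" and HK: "H \<inter> K = {}"
  shows "doubly_connected_separating (- (H \<union> K))"
proof -
  define A where "A = Some ` H"
  define B where "B = insert None (Some ` K)"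
  have union: "topspace riemann_sphere - Some ` (- (H \<union> K)) = A \<union> B"
    unfolding topspace_riemann_sphere A_def B_def by auto
  have clA: "closedin riemann_sphere A"
    unfolding A_def riemann_sphere_def using H(1) by (simp add: compact_imp_closed)
  have clB: "closedin riemann_sphere B"
  proof -
    have "openin riemann_sphere (Some ` (- K))" using K(1) by (intro open_Some_image) auto
    moreover have "x \<in> topspace riemann_sphere - Some ` (- K) \<longleftrightarrow> x \<in> B" for x
      by (cases x) (auto simp: B_def topspace_riemann_sphere)
    then have "topspace riemann_sphere - Some ` (- K) = B" by blast
    ultimately show ?thesis
      using closedin_diff[OF closedin_topspace] by metis
  qed
  have Some_conn: "connectedin riemann_sphere (Some ` S)" if "connected S" for S :: "complex set"
    unfolding riemann_sphere_def using that
    by (intro connectedin_continuous_map_image[OF continuous_map_Some]) simp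
  \<comment> \<open>Neighbourhoods of infinity are complements of compact sets, which the unbounded
    \<open>K\<close> must meet. So adding infinity to \<open>K\<close> keeps it connected.\<close>
  have "None \<in> riemann_sphere closure_of (Some ` K)"
  proof (clarsimp simp: in_closure_of topspace_riemann_sphere)
    fix T assume T: "None \<in> T" "openin riemann_sphere T"
    then obtain C where C: "compact C" "T = insert None (Some ` (- C))"
      unfolding riemann_sphere_def openin_Alexandroff_compactification by (auto simp: Compl_eq_Diff_UNIV)
    have "\<not> K \<subseteq> C" using C(1) K(3) by (meson bounded_subset compact_imp_bounded)
    then show "\<exists>y\<in>K. Some y \<in> T" using C by auto
  qed
  then have "B \<subseteq> riemann_sphere closure_of (Some ` K)"
    unfolding B_def using closure_of_subset[of "Some ` K" riemann_sphere] by (simp add: topspace_riemann_sphere)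
  then have coB: "connectedin riemann_sphere B"
    by (intro connectedin_intermediate_closure_of[OF Some_conn[OF K(2)]]) (auto simp: B_def)
  have coA: "connectedin riemann_sphere A" unfolding A_def by (rule Some_conn[OF H(2)])
  have "connected_components_of (subtopology riemann_sphere (A \<union> B)) = {A, B}"
  proof (rule connected_components_of_two_closed)
    show "topspace (subtopology riemann_sphere (A \<union> B)) = A \<union> B"
      by (simp add: topspace_riemann_sphere)
    show "A \<inter> B = {}" using HK by (auto simp: A_def B_def)
    show "closedin (subtopology riemann_sphere (A \<union> B)) A" "closedin (subtopology riemann_sphere (A \<union> B)) B"
      using clA clB by (auto intro: closedin_subset_topspace)
    show "connectedin (subtopology riemann_sphere (A \<union> B)) A" "connectedin (subtopology riemann_sphere (A \<union> B)) B"
      using coA coB by (auto simp: connectedin_subtopology)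
  qed (use H(3) in \<open>auto simp: A_def B_def\<close>)
  moreover have "A \<noteq> B" "Some 0 \<in> A" "None \<in> B" using H(3) by (auto simp: A_def B_def)
  ultimately show ?thesis
    unfolding doubly_connected_separating_def union by blast
qed

section \<open>Construction of the domains\<close>

lemma bounded_in_punctured_planeI:
  assumes "G \<subseteq> K" "compact K" "0 \<notin> K"
  shows "bounded_in_punctured_plane G"
proof -
  have "closedin riemann_sphere (Some ` K)"
    unfolding riemann_sphere_def using assms(2) by (simp add: compact_imp_closed)
  then have "riemann_sphere closure_of (Some ` G) \<subseteq> Some ` K"
    using assms(1) by (intro closure_of_minimal) auto
  then show ?thesis using assms by (auto simp: bounded_in_punctured_plane_def)
qed

text \<open>Removing 0 leaves \<open>V\<close> path-connected, so a path in the punctured plane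
  joins the two sides of the annulus.\<close>

lemma open_connected_meets_tame_escape:
  assumes c: "c \<ge> 100" and l: "l \<ge> ln c + 100" and \<sigma>: "\<sigma> = 1 \<or> \<sigma> = (-1 :: real)"
    and V: "open V" "connected V"
    and X: "open X" "V \<inter> X \<noteq> {}" "\<And>z. z \<in> X \<Longrightarrow> z \<noteq> 0 \<Longrightarrow> \<sigma> * ln (cmod z) \<le> l"
    and Y: "open Y" "V \<inter> Y \<noteq> {}" "\<And>z. z \<in> Y \<Longrightarrow> z \<noteq> 0 \<Longrightarrow> l + 10 \<le> \<sigma> * ln (cmod z)"
  shows "\<exists>z\<in>V \<inter> tame_escape c. l \<le> \<sigma> * ln (cmod z) \<and> \<sigma> * ln (cmod z) \<le> l + 10"
proof -
  have nonzero: "\<exists>p. p \<in> V \<inter> S \<and> p \<noteq> 0" if "open S" "V \<inter> S \<noteq> {}" for S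
  proof (rule ccontr)
    assume "\<not> ?thesis"
    then have "V \<inter> S = {0}" using that(2) by blast
    moreover have "open (V \<inter> S)" using that V by blast
    ultimately show False using not_open_singleton[of "0::complex"] by simp
  qed
  obtain p where p: "p \<in> V" "p \<in> X" "p \<noteq> 0" using nonzero[OF X(1,2)] by blast
  obtain q where q: "q \<in> V" "q \<in> Y" "q \<noteq> 0" using nonzero[OF Y(1,2)] by blast
  have "path_connected (V - {0})"
    using V by (intro connected_open_path_connected connected_open_delete) auto
  then obtain g where g: "path g" "path_image g \<subseteq> V - {0}" "pathstart g = p" "pathfinish g = q"
    using p q unfolding path_connected_def by blast
  have "\<exists>z\<in>path_image g \<inter> tame_escape c. l \<le> \<sigma> * ln (cmod z) \<and> \<sigma> * ln (cmod z) \<le> l + 10"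
  proof (rule path_meets_tame_escape[OF c l g(1) _ \<sigma>])
    show "0 \<notin> path_image g" using g(2) by blast
    show "p \<in> path_image g" "q \<in> path_image g"
      using g(3,4) pathstart_in_path_image[of g] pathfinish_in_path_image[of g] by auto
  qed (use X(3) Y(3) p q in auto)
  then show ?thesis using g(2) by blast
qed

text \<open>\<open>G1\<close> cuts off infinity and \<open>G2\<close> cuts off 0, both along pieces
  of \<open>tame_escape c\<close> in log annuli of width 10. They cover the plane, so their
  intersection is connected by unicoherence.\<close>

lemma escape_domain:
  assumes c: "c \<ge> 100" and l: "l \<ge> ln c + 100"
  obtains G where "open G" "connected G" "frontier G \<subseteq> tame_escape c"
    "\<And>z. z \<noteq> 0 \<Longrightarrow> lnorm z < l \<Longrightarrow> z \<in> G" "G \<subseteq> log_annulus (- (l + 10)) (l + 10)"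
    "doubly_connected_separating G"
proof -
  have l0: "l \<ge> 100" using c l ln_ge_zero[of c] by linarith
  have c0: "c > 0" using c by simp
  have ln_iff: "exp a < cmod z \<longleftrightarrow> a < ln (cmod z)" "cmod z < exp a \<longleftrightarrow> ln (cmod z) < a" if "z \<noteq> 0" for a z
    using that by (metis exp_less_cancel_iff exp_ln zero_less_norm_iff)+
  define E1 where "E1 = tame_escape c \<inter> log_annulus l (l + 10)"
  define E2 where "E2 = tame_escape c \<inter> log_annulus (- (l + 10)) (- l)"
  have E: "closed E1" "closed E2"
    unfolding E1_def E2_def using compact_tame_escape_annulus[OF c0] compact_imp_closed by blast+
  have conn: "connected (- cball 0 r :: complex set)" for r
    by (rule connected_complement_bounded_convex) auto
  have ne: "- cball 0 r \<noteq> ({} :: complex set)" for r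
    using not_bounded_UNIV[where 'a = complex] bounded_cball[of "0::complex" r] by (metis Compl_empty_eq double_complement)
  obtain G1 where G1: "open G1" "connected G1" "connected (- G1)" "ball 0 (exp l) \<subseteq> G1"
      "- cball 0 (exp (l + 10)) \<inter> G1 = {}" "frontier G1 \<subseteq> E1"
  proof (rule separating_domain[OF E(1), of "ball 0 (exp l)" "- cball 0 (exp (l + 10))"])
    show "ball 0 (exp l) \<inter> E1 = {}" "- cball 0 (exp (l + 10)) \<inter> E1 = {}"
      unfolding E1_def log_annulus_altdef by auto
    fix V :: "complex set"
    assume V: "open V" "connected V" "V \<inter> ball 0 (exp l) \<noteq> {}" "V \<inter> - cball 0 (exp (l + 10)) \<noteq> {}"
    have "\<exists>z\<in>V \<inter> tame_escape c. l \<le> 1 * ln (cmod z) \<and> 1 * ln (cmod z) \<le> l + 10"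
    proof (rule open_connected_meets_tame_escape[OF c l _ V(1,2) _ V(3) _ _ V(4)])
      show "1 * ln (cmod z) \<le> l" if "z \<in> ball 0 (exp l)" "z \<noteq> 0" for z
        using that ln_iff[OF that(2)] by auto
      show "l + 10 \<le> 1 * ln (cmod z)" if "z \<in> - cball 0 (exp (l + 10))" "z \<noteq> 0" for z
        using that ln_iff[OF that(2)] by (auto simp: not_le)
    qed auto
    then show "V \<inter> E1 \<noteq> {}"
      unfolding E1_def log_annulus_def tame_escape_def by auto
  qed (use conn ne in auto)
  obtain G2 where G2: "open G2" "connected G2" "connected (- G2)" "- cball 0 (exp (- l)) \<subseteq> G2"
      "ball 0 (exp (- (l + 10))) \<inter> G2 = {}" "frontier G2 \<subseteq> E2"
  proof (rule separating_domain[OF E(2), of "- cball 0 (exp (- l))" "ball 0 (exp (- (l + 10)))"])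
    show "- cball 0 (exp (- l)) \<inter> E2 = {}" "ball 0 (exp (- (l + 10))) \<inter> E2 = {}"
      unfolding E2_def log_annulus_altdef by auto
    fix V :: "complex set"
    assume V: "open V" "connected V" "V \<inter> - cball 0 (exp (- l)) \<noteq> {}" "V \<inter> ball 0 (exp (- (l + 10))) \<noteq> {}"
    have "\<exists>z\<in>V \<inter> tame_escape c. l \<le> (- 1) * ln (cmod z) \<and> (- 1) * ln (cmod z) \<le> l + 10"
    proof (rule open_connected_meets_tame_escape[OF c l _ V(1,2) _ V(3) _ _ V(4)])
      show "(- 1) * ln (cmod z) \<le> l" if "z \<in> - cball 0 (exp (- l))" "z \<noteq> 0" for z
        using that ln_iff[OF that(2)] by (auto simp: not_le)
      show "l + 10 \<le> (- 1) * ln (cmod z)" if "z \<in> ball 0 (exp (- (l + 10)))" "z \<noteq> 0" for z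
        using that ln_iff(2)[OF that(2), of "- (l + 10)"] by auto
    qed auto
    then show "V \<inter> E2 \<noteq> {}"
      unfolding E2_def log_annulus_def tame_escape_def by auto
  qed (use conn ne in auto)
  have ll: "exp (- l) < exp l" using l0 by simp
  have cover: "G1 \<union> G2 = UNIV"
  proof -
    have "cmod z < exp l \<or> exp (- l) < cmod z" for z using ll by linarith
    then have "z \<in> ball 0 (exp l) \<or> z \<in> - cball 0 (exp (- l))" for z :: complex by (simp add: not_le)
    then show ?thesis using G1(4) G2(4) by blast
  qed
  \<comment> \<open>\<open>- G2\<close> is the bounded piece of the complement around 0, and
    \<open>- G1\<close> is the piece reaching infinity.\<close>
  have eq: "G1 \<inter> G2 = - (- G2 \<union> - G1)" by blast
  show thesis
  proof (rule that[of "G1 \<inter> G2"])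
    show "open (G1 \<inter> G2)" using G1(1) G2(1) by blast
    show "connected (G1 \<inter> G2)"
      by (rule open_unicoherent_UNIV[OF G1(1) G2(1) G1(2) G2(2) cover])
    show "frontier (G1 \<inter> G2) \<subseteq> tame_escape c"
      using frontier_Int_subset[of G1 G2] G1(6) G2(6) unfolding E1_def E2_def by blast
    show "z \<in> G1 \<inter> G2" if z: "z \<noteq> 0" "lnorm z < l" for z
    proof -
      have "cmod z < exp l" "exp (- l) < cmod z" using ln_iff[OF z(1)] z(2) by auto
      then show ?thesis using G1(4) G2(4) by (auto simp: subset_iff not_le)
    qed
    show "G1 \<inter> G2 \<subseteq> log_annulus (- (l + 10)) (l + 10)"
      unfolding log_annulus_altdef using G1(5) G2(5) by blast
    show "doubly_connected_separating (G1 \<inter> G2)"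
      unfolding eq
    proof (rule doubly_connected_separatingI)
      have "- G2 \<subseteq> cball 0 (exp (- l))" using G2(4) by blast
      then show "compact (- G2)"
        using G2(1) by (metis bounded_cball bounded_subset closed_Compl compact_eq_bounded_closed)
      have "0 \<in> ball (0::complex) (exp (- (l + 10)))" by simp
      then show "0 \<in> - G2" using G2(5) by blast
      show "\<not> bounded (- G1)"
      proof
        assume "bounded (- G1)"
        moreover have "- cball 0 (exp (l + 10)) \<subseteq> - G1" using G1(5) by blast
        ultimately have "bounded (- cball 0 (exp (l + 10)) :: complex set)" by (rule bounded_subset)
        then have "bounded (- cball 0 (exp (l + 10)) \<union> cball 0 (exp (l + 10)) :: complex set)"
          by (simp only: bounded_Un bounded_cball simp_thms)
        then show False using not_bounded_UNIV[where 'a = complex] by (simp only: Compl_partition2)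
      qed
      show "- G2 \<inter> - G1 = {}" using cover by blast
      show "connected (- G2)" "connected (- G1)" by (fact G2(3) G1(3))+
      show "closed (- G1)" using G1(1) by (rule closed_Compl)
    qed
  qed
qed

section \<open>Connectedness of the escaping set\<close>

lemma holomorphic_on_iterate_f_lam:
  assumes "c > 0"
  shows "(f_lam c ^^ n) holomorphic_on - {0}"
proof (induction n)
  case (Suc n)
  have f: "f_lam c holomorphic_on - {0}"
    unfolding f_lam_def by (intro holomorphic_intros) auto
  have im: "(f_lam c ^^ n) ` (- {0}) \<subseteq> - {0}"
    using iterate_f_lam_nonzero[OF assms] by (intro image_subsetI) simp
  have "(f_lam c \<circ> (f_lam c ^^ n)) holomorphic_on - {0}"
    by (rule holomorphic_on_compose_gen[OF Suc f im])
  then show ?case by (simp add: comp_def)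
qed (auto simp: id_def intro: holomorphic_intros)

lemma connected_haven: "connected haven"
proof -
  have "convex {z::complex. 1 \<le> Re z}"
    using convex_halfspace_Re_ge[of 1] by simp
  moreover have "convex ({z. Im z = 0} \<inter> {z. 0 < Re z})"
    by (intro convex_Int convex_halfspace_Re_gt) (auto simp: convex_def)
  then have "convex {z. Im z = 0 \<and> 0 < Re z}" by (simp add: Collect_conj_eq)
  moreover have "1 \<in> {z. 1 \<le> Re z} \<inter> {z. Im z = 0 \<and> 0 < Re z}" by simp
  then have "{z. 1 \<le> Re z} \<inter> {z. Im z = 0 \<and> 0 < Re z} \<noteq> {}" by (metis empty_iff)
  ultimately show ?thesis
    unfolding haven_def by (intro connected_Un convex_connected) auto
qed

section \<open>A continuum separating a point of a disconnected set\<close>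

lemma disconnected_open_separation:
  fixes S P :: "'a::euclidean_space set"
  assumes "\<not> connected S" "connected P" "P \<subseteq> S"
  obtains U V where "open U" "open V" "U \<inter> V = {}" "S \<subseteq> U \<union> V" "P \<subseteq> U" "S \<inter> V \<noteq> {}"
proof -
  obtain C D where CD: "C \<union> D = S" "C \<noteq> {}" "D \<noteq> {}" "C \<inter> closure D = {}" "D \<inter> closure C = {}"
    using assms(1) unfolding connectedin_eq_not_separated[of euclidean S, simplified]
    by (auto simp: separatedin_def)
  obtain U V where UV: "U \<inter> V = {}" "open U" "open V" "C \<subseteq> U" "D \<subseteq> V"
    using separation_closures[OF CD(4,5)] by blast
  have "P \<subseteq> U \<or> P \<subseteq> V"
  proof -
    have "P \<subseteq> U \<union> V" using assms(3) CD(1) UV by blast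
    then have "U \<inter> P = {} \<or> V \<inter> P = {}"
      using connectedD[OF assms(2) UV(2,3)] UV(1) by blast
    then show ?thesis using \<open>P \<subseteq> U \<union> V\<close> by blast
  qed
  then show thesis
  proof
    assume "P \<subseteq> U"
    then show thesis using that[of U V] UV CD by blast
  next
    assume "P \<subseteq> V"
    then show thesis using that[of V U] UV CD by blast
  qed
qed

text \<open>Split \<open>S\<close> by disjoint open sets \<open>U\<close> and \<open>V\<close>; the
  frontier of \<open>V\<close> then misses \<open>S\<close>. Let \<open>\<Omega>\<close> be the
  component of \<open>V\<close> at \<open>z\<close>, and \<open>N\<close> the component of
  \<open>- closure \<Omega>\<close> containing \<open>P\<close>. A component of the complement of a
  connected planar set has connected frontier.\<close>

lemma surrounding_continuum:
  fixes S P :: "complex set"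
  assumes S: "\<not> connected S" "connected P" "P \<subseteq> S" "P \<noteq> {}"
  obtains N z where "open N" "connected N" "connected (frontier N)" "frontier N \<inter> S = {}"
    "P \<subseteq> N" "z \<in> S" "z \<notin> closure N"
proof -
  obtain U V where UV: "open U" "open V" "U \<inter> V = {}" "S \<subseteq> U \<union> V" "P \<subseteq> U" "S \<inter> V \<noteq> {}"
    using disconnected_open_separation[OF S(1-3)] .
  then obtain z where z: "z \<in> S" "z \<in> V" by blast
  define \<Omega> where "\<Omega> = connected_component_set V z"
  have \<Omega>: "open \<Omega>" "connected \<Omega>" "z \<in> \<Omega>" "\<Omega> \<subseteq> V"
    using z UV(2) by (auto simp: \<Omega>_def open_connected_component connected_component_subset)
  have UcV: "U \<inter> closure V = {}" using UV(1,3) by (simp add: open_Int_closure_eq_empty)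
  have "frontier \<Omega> \<subseteq> frontier V" unfolding \<Omega>_def by (rule frontier_of_connected_component_subset)
  also have "frontier V \<inter> S = {}"
    using UcV UV(2,4) by (auto simp: frontier_def interior_open)
  finally have fS: "frontier \<Omega> \<inter> S = {}" by blast
  have "closure \<Omega> \<subseteq> closure V" using \<Omega>(4) by (rule closure_mono)
  then have "P \<subseteq> - closure \<Omega>" using UV(5) UcV by blast
  then obtain N where N: "N \<in> components (- closure \<Omega>)" "P \<subseteq> N"
    using exists_component_superset[of P "- closure \<Omega>"] S(2,4) by blast
  have "frontier N \<subseteq> frontier (- closure \<Omega>)" by (rule frontier_of_components_subset[OF N(1)])
  also have "\<dots> \<subseteq> frontier \<Omega>" using frontier_closure_subset[of \<Omega>] by simp
  finally have fN: "frontier N \<subseteq> frontier \<Omega>" .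
  have "N \<inter> closure \<Omega> = {}" using in_components_subset[OF N(1)] by blast
  then have "closure N \<inter> \<Omega> = {}"
    using \<Omega>(1) closure_subset[of \<Omega>] by (metis disjoint_iff inf_commute open_Int_closure_eq_empty subsetD)
  show thesis
  proof (rule that[of N z])
    show "open N" by (rule open_components[OF _ N(1)]) (simp add: open_Compl)
    show "connected N" using N(1) by (rule in_components_connected)
    show "connected (frontier N)"
      by (rule connected_frontier_component_complement[OF connected_imp_connected_closure[OF \<Omega>(2)] N(1)])
    show "frontier N \<inter> S = {}" using fN fS by blast
    show "z \<notin> closure N" using \<open>closure N \<inter> \<Omega> = {}\<close> \<Omega>(3) by blast
  qed (use N z in auto)
qed

text \<open>The maximum principle is applied to \<open>F\<close> and to its reciprocal, since
  \<open>lnorm\<close> measures distance from both ends.\<close>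

lemma maximum_modulus_log:
  assumes F: "F holomorphic_on - {0}" "\<And>z. z \<noteq> 0 \<Longrightarrow> F z \<noteq> 0"
    and W: "bounded W" "closure W \<subseteq> - {0}" "\<xi> \<in> W"
    and b: "\<And>w. w \<in> frontier W \<Longrightarrow> lnorm (F w) \<le> b"
  shows "lnorm (F \<xi>) \<le> b"
proof -
  have nz: "F w \<noteq> 0" if "w \<in> closure W" for w using that W(2) F(2)[of w] by auto
  have fr: "frontier W \<subseteq> closure W" by (simp add: frontier_def)
  have sub: "interior W \<subseteq> - {0}" using W(2) interior_subset[of W] closure_subset[of W] by blast
  have F1: "(\<lambda>z. inverse (F z)) holomorphic_on - {0}"
    using F by (intro holomorphic_intros) auto
  have "cmod (F \<xi>) \<le> exp b"
  proof (rule maximum_modulus_frontier[OF _ _ W(1) _ W(3)])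
    show "F holomorphic_on interior W" using F(1) sub by (rule holomorphic_on_subset)
    show "continuous_on (closure W) F"
      using F(1) W(2) by (meson continuous_on_subset holomorphic_on_imp_continuous_on)
    show "cmod (F w) \<le> exp b" if "w \<in> frontier W" for w
    proof -
      have "ln (cmod (F w)) \<le> b" using b[OF that] by linarith
      then have "exp (ln (cmod (F w))) \<le> exp b" by simp
      moreover have "F w \<noteq> 0" using nz that fr by blast
      ultimately show ?thesis by simp
    qed
  qed
  moreover have "cmod (inverse (F \<xi>)) \<le> exp b"
  proof (rule maximum_modulus_frontier[OF _ _ W(1) _ W(3)])
    show "(\<lambda>z. inverse (F z)) holomorphic_on interior W" using F1 sub by (rule holomorphic_on_subset)
    show "continuous_on (closure W) (\<lambda>z. inverse (F z))"
      using F1 W(2) by (meson continuous_on_subset holomorphic_on_imp_continuous_on)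
    show "cmod (inverse (F w)) \<le> exp b" if "w \<in> frontier W" for w
    proof -
      have "- ln (cmod (F w)) \<le> b" using b[OF that] by linarith
      then have "exp (- ln (cmod (F w))) \<le> exp b" by simp
      moreover have "F w \<noteq> 0" using nz that fr by blast
      ultimately show ?thesis by (simp add: exp_minus norm_inverse)
    qed
  qed
  moreover have "F \<xi> \<noteq> 0" using nz W(3) closure_subset[of W] by blast
  then have pos: "cmod (F \<xi>) > 0" by simp
  ultimately have "ln (cmod (F \<xi>)) \<le> ln (exp b)" "ln (cmod (inverse (F \<xi>))) \<le> ln (exp b)"
    by (auto simp del: ln_exp simp: \<open>F \<xi> \<noteq> 0\<close>)
  then show ?thesis using pos by (simp add: norm_inverse ln_inverse)
qed

lemma connected_escaping_set:
  assumes c: "c \<ge> 100"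
  shows "connected (escaping_set (f_lam c))"
proof (rule ccontr)
  let ?I = "escaping_set (f_lam c)"
  assume "\<not> connected ?I"
  have c0: "c > 0" using c by simp
  have havI: "haven \<subseteq> ?I" using haven_escaping c by auto
  have hav: "of_real r \<in> haven" if "r > 0" for r using that by (simp add: haven_def)
  have tame: "tame_escape c \<subseteq> ?I" using tame_escape_subset c by simp
  obtain N z where N: "open N" "connected N" "connected (frontier N)" "frontier N \<inter> ?I = {}"
    "haven \<subseteq> N" "z \<in> ?I" "z \<notin> closure N"
    using surrounding_continuum[OF \<open>\<not> connected ?I\<close> connected_haven havI] hav[of 1] by force
  define \<Gamma> where "\<Gamma> = frontier N"
  have \<Gamma>: "connected \<Gamma>" "closed \<Gamma>" "\<Gamma> \<inter> ?I = {}" "N \<inter> \<Gamma> = {}"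
    using N by (auto simp: \<Gamma>_def frontier_def interior_open)
  \<comment> \<open>\<open>N\<close> contains the positive half-line, so a connected set meeting
    that line leaves \<open>N\<close> only through \<open>\<Gamma>\<close>.\<close>
  have enter: "C \<subseteq> N" if "connected C" "C \<inter> \<Gamma> = {}" "of_real r \<in> C" "r > 0" for C r
  proof (rule ccontr)
    assume "\<not> C \<subseteq> N"
    moreover have "C \<inter> N \<noteq> {}" using that(3) hav[OF that(4)] N(5) by blast
    ultimately have "C \<inter> frontier N \<noteq> {}" using connected_Int_frontier[OF that(1)] by blast
    with that(2) show False by (simp add: \<Gamma>_def)
  qed
  have z0: "z \<noteq> 0" using N(6) by (simp add: escaping_set_def)
  have zN: "z \<notin> N" "z \<notin> \<Gamma>" using N(7) closure_subset \<Gamma>(3) N(6) by auto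
  have "\<exists>q\<in>\<Gamma>. q \<noteq> 0"
  proof (rule ccontr)
    assume "\<not> ?thesis"
    moreover have "connected (- {0 :: complex})"
      by (rule connected_punctured_universe) simp
    ultimately have "- {0} \<subseteq> N" using enter[of "- {0}" 1] by force
    then show False using z0 zN by blast
  qed
  then obtain q where q: "q \<in> \<Gamma>" "q \<noteq> 0" by blast
  \<comment> \<open>A web domain around \<open>q\<close> must contain all of
    \<open>\<Gamma>\<close>: its frontier escapes, whereas \<open>\<Gamma>\<close> is connected and
    has no escaping point. Thus \<open>\<Gamma>\<close> stays away from 0 and infinity.\<close>
  obtain l where l: "l \<ge> ln c + 100" "lnorm q < l"
    using that[of "max (ln c + 100) (lnorm q + 1)"] by linarith
  define b where "b = l + 10"
  obtain G where G: "frontier G \<subseteq> tame_escape c" "\<And>z. z \<noteq> 0 \<Longrightarrow> lnorm z < l \<Longrightarrow> z \<in> G"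
    "G \<subseteq> log_annulus (- b) b"
    using escape_domain[OF c l(1)] unfolding b_def by metis
  have "\<Gamma> \<subseteq> G"
  proof (rule ccontr)
    assume "\<not> \<Gamma> \<subseteq> G"
    moreover have "\<Gamma> \<inter> G \<noteq> {}" using G(2)[OF q(2) l(2)] q(1) by blast
    ultimately have "\<Gamma> \<inter> frontier G \<noteq> {}" using connected_Int_frontier[OF \<Gamma>(1)] by blast
    then show False using G(1) tame \<Gamma>(3) by blast
  qed
  then have \<Gamma>ann: "\<Gamma> \<subseteq> cball 0 (exp b) - ball 0 (exp (- b))"
    using G(3) unfolding log_annulus_altdef by blast
  \<comment> \<open>By \<open>enter\<close>, neighbourhoods of 0 and of infinity lie in
    \<open>N\<close>. The component \<open>W\<close> avoids \<open>N\<close>, so it is bounded in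
    the punctured plane, as the maximum principle requires.\<close>
  define W where "W = connected_component_set (- \<Gamma>) z"
  have W: "connected W" "z \<in> W" "W \<inter> \<Gamma> = {}"
    using zN connected_component_subset[of "- \<Gamma>" z] by (auto simp: W_def)
  have WN: "W \<inter> N = {}"
  proof (rule ccontr)
    assume "W \<inter> N \<noteq> {}"
    then have "W \<inter> frontier N \<noteq> {}" using connected_Int_frontier[OF W(1)] W(2) zN by blast
    then show False using W(3) by (simp add: \<Gamma>_def)
  qed
  have "- cball 0 (exp b) \<subseteq> N"
  proof (rule enter[of _ "exp b + 1"])
    show "connected (- cball 0 (exp b) :: complex set)"
      by (rule connected_complement_bounded_convex) auto
    have "cmod (of_real (exp b + 1)) = exp b + 1" by (simp only: norm_of_real) (simp add: add_pos_pos)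
    then show "of_real (exp b + 1) \<in> - cball (0::complex) (exp b)"
      unfolding Compl_iff mem_cball_0 by linarith
  qed (use \<Gamma>ann in \<open>auto simp: add_pos_pos\<close>)
  moreover have "ball 0 (exp (- b)) \<subseteq> N"
    by (rule enter[of _ "exp (- b) / 2"]) (use \<Gamma>ann in auto)
  ultimately have Wann: "W \<subseteq> log_annulus (- b) b"
    using WN unfolding log_annulus_altdef by blast
  have Wcl: "closure W \<subseteq> log_annulus (- b) b"
    using Wann compact_imp_closed[OF compact_log_annulus] by (rule closure_minimal)
  have Wb: "bounded W" "closure W \<subseteq> - {0}"
    using Wann compact_imp_bounded[OF compact_log_annulus] bounded_subset Wcl
    by (blast, auto simp: log_annulus_def)
  have "frontier W \<subseteq> frontier (- \<Gamma>)" unfolding W_def by (rule frontier_of_connected_component_subset)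
  then have Wfr: "frontier W \<subseteq> \<Gamma>" using \<Gamma>(2) frontier_subset_closed[of \<Gamma>] by auto
  have "\<forall>\<^sub>F n in sequentially. m < lnorm ((f_lam c ^^ n) q)" for m
  proof -
    \<comment> \<open>\<open>D\<close> is a web domain containing every nonzero point with
      \<open>lnorm\<close> less than \<open>k\<close>, and \<open>k > m\<close>. Once the image of
      \<open>q\<close> is outside \<open>D\<close>, its \<open>lnorm\<close> exceeds
      \<open>m\<close>.\<close>
    define k where "k = max (ln c + 100) (m + 1)"
    have k: "k \<ge> ln c + 100" "m < k" by (auto simp: k_def)
    obtain D where D: "frontier D \<subseteq> tame_escape c" "\<And>z. z \<noteq> 0 \<Longrightarrow> lnorm z < k \<Longrightarrow> z \<in> D"
      "D \<subseteq> log_annulus (- (k + 10)) (k + 10)"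
      using escape_domain[OF c k(1)] by metis
    have "\<forall>\<^sub>F n in sequentially. k + 10 < lnorm ((f_lam c ^^ n) z)"
      using N(6) c0 by (simp add: f_lam_escaping_iff)
    then show ?thesis
    proof eventually_elim
      case (elim n)
      let ?F = "f_lam c ^^ n"
      \<comment> \<open>The image of \<open>z\<close> is beyond the annulus containing
        \<open>D\<close>, and the frontier of \<open>W\<close> lies in \<open>\<Gamma>\<close>; so
        some point of \<open>\<Gamma>\<close> is also sent outside \<open>D\<close>. The connected
        image of \<open>\<Gamma>\<close> misses \<open>frontier D\<close>, hence all of it is
        outside \<open>D\<close>.\<close>
      have "\<exists>w\<in>\<Gamma>. k + 10 < lnorm (?F w)"
      proof (rule ccontr)
        assume "\<not> ?thesis"
        then have "lnorm (?F w) \<le> k + 10" if "w \<in> frontier W" for w using that Wfr by force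
        with maximum_modulus_log[OF holomorphic_on_iterate_f_lam[OF c0] iterate_f_lam_nonzero[OF c0] Wb W(2)]
        have "lnorm (?F z) \<le> k + 10" by blast
        with elim show False by simp
      qed
      then obtain w where w: "w \<in> \<Gamma>" "k + 10 < lnorm (?F w)" by blast
      have \<Gamma>0: "\<Gamma> \<subseteq> - {0}" using \<open>\<Gamma> \<subseteq> G\<close> G(3) by (auto simp: log_annulus_def)
      have "?F w \<notin> D"
      proof
        assume "?F w \<in> D"
        then have "?F w \<in> log_annulus (- (k + 10)) (k + 10)" using D(3) by blast
        then show False using w(2) by (auto simp: log_annulus_def)
      qed
      moreover have "connected (?F ` \<Gamma>)"
        using \<Gamma>(1) \<Gamma>0 continuous_on_iterate_f_lam[OF c0]
        by (intro connected_continuous_image) (auto intro: continuous_on_subset)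
      moreover have "?F ` \<Gamma> \<inter> frontier D = {}"
      proof (rule ccontr)
        assume "?F ` \<Gamma> \<inter> frontier D \<noteq> {}"
        then obtain p where "p \<in> \<Gamma>" "?F p \<in> ?I" using D(1) tame by blast
        then have "p \<in> ?I" using escaping_set_preimage[OF c0] \<Gamma>0 by blast
        then show False using \<Gamma>(3) \<open>p \<in> \<Gamma>\<close> by blast
      qed
      ultimately have "?F ` \<Gamma> \<inter> D = {}"
        using connected_Int_frontier[of "?F ` \<Gamma>" D] w(1) by blast
      then have "?F q \<notin> D" using q(1) by blast
      then have "\<not> lnorm (?F q) < k" using D(2) iterate_f_lam_nonzero[OF c0 q(2)] by blast
      then show ?case using k(2) by linarith
    qed
  qed
  then have "q \<in> ?I" using q(2) c0 by (simp add: f_lam_escaping_iff)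
  then show False using q(1) \<Gamma>(3) by blast
qed

section \<open>Assembling the web\<close>

lemma escaping_set_spiders_web:
  assumes c: "c \<ge> 100"
  shows "punctured_spiders_web (escaping_set (f_lam c))"
proof -
  let ?I = "escaping_set (f_lam c)"
  \<comment> \<open>The increment 11 exceeds the width 10 of the annuli, which nests successive
    domains.\<close>
  define l where "l = (\<lambda>n. ln c + 100 + 11 * real n)"
  have lc: "l n \<ge> ln c + 100" for n by (simp add: l_def)
  have "\<exists>G. open G \<and> connected G \<and> frontier G \<subseteq> tame_escape c \<and>
      (\<forall>z. z \<noteq> 0 \<longrightarrow> lnorm z < l n \<longrightarrow> z \<in> G) \<and> G \<subseteq> log_annulus (- (l n + 10)) (l n + 10) \<and>
      doubly_connected_separating G" for n
    using escape_domain[OF c lc[of n]] by metis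
  then obtain G where G: "\<And>n. open (G n)" "\<And>n. connected (G n)" "\<And>n. frontier (G n) \<subseteq> tame_escape c"
    "\<And>n z. z \<noteq> 0 \<Longrightarrow> lnorm z < l n \<Longrightarrow> z \<in> G n" "\<And>n. G n \<subseteq> log_annulus (- (l n + 10)) (l n + 10)"
    "\<And>n. doubly_connected_separating (G n)"
    by metis
  have G0: "G n \<subseteq> - {0}" for n using G(5)[of n] by (auto simp: log_annulus_def)
  have l0: "l n > 0" for n
    unfolding l_def using c ln_ge_zero[of c] of_nat_0_le_iff[of n] by linarith
  have "domain_in_plane (G n)" for n
    using G(1,2)[of n] G(4)[of 1 n] l0[of n] by (auto simp: domain_in_plane_def)
  moreover have "bounded_in_punctured_plane (G n)" for n
    by (rule bounded_in_punctured_planeI[OF G(5) compact_log_annulus]) (simp add: log_annulus_def)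
  moreover have "G n \<subseteq> G (Suc n)" for n
  proof
    fix z assume "z \<in> G n"
    then have "z \<noteq> 0" "lnorm z \<le> l n + 10" using G(5)[of n] by (auto simp: log_annulus_def)
    then show "z \<in> G (Suc n)" by (intro G(4)) (auto simp: l_def)
  qed
  moreover have "frontier (G n) \<subseteq> ?I" for n
    using G(3) tame_escape_subset[of c] c by force
  moreover have "(\<Union>n. G n) = - {0}"
  proof
    show "- {0} \<subseteq> (\<Union>n. G n)"
    proof
      fix z :: complex assume z: "z \<in> - {0}"
      obtain n where "lnorm z < real n" using reals_Archimedean2 by blast
      moreover have "real n \<le> l n" using c ln_ge_zero[of c] by (simp add: l_def)
      ultimately show "z \<in> (\<Union>n. G n)" using G(4)[of z n] z by auto
    qed
  qed (use G0 in blast)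
  moreover have "?I \<subseteq> - {0}" by (auto simp: escaping_set_def)
  ultimately show ?thesis
    unfolding punctured_spiders_web_def using connected_escaping_set[OF c] G(6) by blast
qed

section \<open>Essential singularities and conclusion\<close>

text \<open>Growth along the positive axis excludes a finite limit, and decay along the negative
  axis excludes a pole.\<close>

lemma essential_singularity_at_0I:
  assumes g: "g holomorphic_on - {0}"
    and right: "filterlim (\<lambda>x. cmod (g (of_real x))) at_top (at_right (0::real))"
    and left: "((\<lambda>x. cmod (g (of_real x))) \<longlongrightarrow> 0) (at_left (0::real))"
  shows "essential_singularity_at g 0"
proof -
  have "g analytic_on - {0}" using g by (subst analytic_on_open) auto
  then have "isolated_singularity_at g 0"
    unfolding isolated_singularity_at_def
    by (intro exI[of _ 1]) (auto intro: analytic_on_subset)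
  moreover have "\<not> not_essential g 0"
  proof
    assume "not_essential g 0"
    have at: "filterlim (of_real :: real \<Rightarrow> complex) (at 0) (at_right 0)"
      "filterlim (of_real :: real \<Rightarrow> complex) (at 0) (at_left 0)"
      by (auto simp: filterlim_at eventually_at_filter intro!: tendsto_eq_intros)
    consider a where "g \<midarrow>0\<rightarrow> a" | "is_pole g 0"
      using \<open>not_essential g 0\<close> unfolding not_essential_def by blast
    then show False
    proof cases
      case 1
      then have "((\<lambda>x. cmod (g (of_real x))) \<longlongrightarrow> cmod a) (at_right (0::real))"
        by (intro tendsto_norm filterlim_compose[OF _ at(1)])
      then show False
        using right not_tendsto_and_filterlim_at_infinity[of "at_right (0::real)"]
          filterlim_at_top_imp_at_infinity trivial_limit_at_right_real by blast
    next
      case 2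
      then have "filterlim (\<lambda>x. g (of_real x)) at_infinity (at_left (0::real))"
        unfolding is_pole_def by (rule filterlim_compose[OF _ at(2)])
      moreover have "((\<lambda>x. g (of_real x)) \<longlongrightarrow> 0) (at_left (0::real))"
        using left by (rule tendsto_norm_zero_cancel)
      ultimately show False
        using not_tendsto_and_filterlim_at_infinity[of "at_left (0::real)"] trivial_limit_at_left_real by blast
    qed
  qed
  ultimately show ?thesis by (simp add: essential_singularity_at_def)
qed

lemma cmod_f_lam_of_real:
  assumes "c > 0"
  shows "cmod (f_lam c (of_real x)) = c * \<bar>x\<bar> * exp (exp (- x) / x)"
proof -
  have "f_lam c (of_real x) = of_real (c * x * exp (exp (- x) / x))"
    by (simp add: f_lam_def exp_of_real flip: of_real_minus of_real_divide)
  then show ?thesis using assms by (simp only: norm_of_real) (simp add: abs_mult)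
qed

lemma transcendental_f_lam:
  assumes c: "c > 0"
  shows "transcendental_self_map (f_lam c)"
proof -
  have hol: "f_lam c holomorphic_on - {0}"
    unfolding f_lam_def by (intro holomorphic_intros) auto
  have "essential_singularity_at (f_lam c) 0"
  proof (rule essential_singularity_at_0I[OF hol])
    show "filterlim (\<lambda>x. cmod (f_lam c (of_real x))) at_top (at_right (0::real))"
      unfolding cmod_f_lam_of_real[OF c] using c by real_asymp
    show "((\<lambda>x. cmod (f_lam c (of_real x))) \<longlongrightarrow> 0) (at_left (0::real))"
      unfolding cmod_f_lam_of_real[OF c] using c by real_asymp
  qed
  moreover have "essential_singularity_at_infinity (f_lam c)"
    unfolding essential_singularity_at_infinity_def
  proof (rule essential_singularity_at_0I)
    show "(\<lambda>w. f_lam c (1 / w)) holomorphic_on - {0}"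
      unfolding f_lam_def by (intro holomorphic_intros) auto
    have eq: "cmod (f_lam c (1 / of_real x)) = c * \<bar>1 / x\<bar> * exp (exp (- (1 / x)) / (1 / x))" for x
      using cmod_f_lam_of_real[OF c, of "1 / x"] by simp
    show "filterlim (\<lambda>x. cmod (f_lam c (1 / of_real x))) at_top (at_right (0::real))"
      unfolding eq using c by real_asymp
    show "((\<lambda>x. cmod (f_lam c (1 / of_real x))) \<longlongrightarrow> 0) (at_left (0::real))"
      unfolding eq using c by real_asymp
  qed
  ultimately show ?thesis
    using hol c by (auto simp: transcendental_self_map_def f_lam_eq_0_iff)
qed

theorem theorem1p5:
  shows "\<exists>c0 :: real. c0 > 0 \<and>
    (\<forall>c :: real. c \<ge> c0 \<longrightarrow>
       transcendental_self_map (f_lam c) \<and>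
       punctured_spiders_web (escaping_set (f_lam c)))"
  \<comment> \<open>The threshold 100 stems from \<open>no_strip_crossing\<close>, where it makes
    the modulus of the image at least 33 times the imaginary part.\<close>
  by (intro exI[of _ 100]) (simp add: transcendental_f_lam escaping_set_spiders_web)

end
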